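(* Let $n\ge1$, $q\ge2$ be integers, $\sigma>0$, $s>0$, $\mu=s^2/\sigma^2$, and let $h(\mathbf X\mid\hat{\mathbf W})$ be the average differential entropy of the Gaussian mixture described in the context. Let $h_\sigma=\ln(\sigma\sqrt{2\pi e})$. Then $$h(\mathbf X\mid\hat{\mathbf W})=n h_\sigma+\frac n2\,\frac{q}{q-1}\,\mu+S,$$ where $$S=-\mathbb E_u\Big[\ln\, q^{-1}\sum_{l=1}^q\exp\Big\{-\frac\mu2\big(G_l+2\delta_{q,l}T\big)\Big\}\Big],$$ with $G_l$, $T$ and the expectation $\mathbb E_u$ as defined in the context.
   Context: Setting: $\mathbf W_1,\dots,\mathbf W_q$ are i.i.d. Gaussian in $\mathbb R^n$ with mean $0$ and covariance $s^2\mathbf 1_n$; given $\hat{\mathbf W}=\hat{\mathbf w}=(\mathbf w_1,\dots,\mathbf w_q)$, $\mathbf X$ has density $(2\pi\sigma^2)^{-n/2}\frac1q\sum_{j=1}^q\exp\{-\|\mathbf x-\mathbf w_j\|^2/(2\sigma^2)\}$; $h(\mathbf X\mid\hat{\mathbf W})=\mathbb E_{\hat{\mathbf w}}[h(\mathbf X\mid\hat{\mathbf W}=\hat{\mathbf w})]$ with $h$ the differential entropy (natural log). The paper works in the regime $\mu<1$. Notation: for $j\in\{1,2\}$, $\lambda_j=\frac12\big((\mu-1)+(-1)^{j+1}\sqrt{\mu^2-(4q^{-1}-2)\mu+1}\big)$, $m_j=\lambda_j+1$, $x_j=1-qm_j$, $N_j=q-1+x_j^2$. For $m=1,\dots,q-2$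 and $l=1,\dots,q$: $\alpha_{m,l}=\frac{1}{\sqrt{m(m+1)}}$ if $l\le m$, $\alpha_{m,l}=\frac{-m}{\sqrt{m(m+1)}}$ if $l=m+1$, and $\alpha_{m,l}=0$ if $l>m+1$. Let $\mathbf u_1,\dots,\mathbf u_q\in\mathbb R^n$ and define $$G_l=\sum_{m,m'=1}^{q-2}\alpha_{m,l}\alpha_{m',l}\,\mathbf u_m\cdot\mathbf u_{m'}+\frac{2}{\sqrt{N_1}}\sum_{m=1}^{q-2}\alpha_{m,l}\,\mathbf u_m\cdot\mathbf u_{q-1}+\frac{2}{\sqrt{N_2}}\sum_{m=1}^{q-2}\alpha_{m,l}\,\mathbf u_m\cdot\mathbf u_q,$$ $$T=\frac{x_2^2-1}{2N_2}\mathbf u_q\cdot\mathbf u_q+\frac{x_1^2-1}{2N_1}\mathbf u_{q-1}\cdot\mathbf u_{q-1}+\frac{x_1x_2-1}{\sqrt{N_1}\sqrt{N_2}}\mathbf u_q\cdot\mathbf u_{q-1}.$$ $\mathbb E_u$ denotes expectation when all coordinates $u_{k,i}$ ($k=1,\dots,q$, $i=1,\dots,n$) of the $\mathbf u_k$ are independent Gaussians with mean $0$ and variance $1/d_k$, where $d_k=1$ for $k\le q-2$, $d_{q-1}=m_1$, $d_q=m_2$. $\delta$ is the Kronecker delta. *)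

theory Defs
  imports "HOL-Probability.Probability"
begin

text \<open>Vectors in R^n are functions nat => real, coordinates indexed by {1..n};
  a q-tuple of vectors is a function nat => nat => real, w k i = i-th coordinate of w_k, k in {1..q}.\<close>

definition dotv :: "nat \<Rightarrow> (nat \<Rightarrow> real) \<Rightarrow> (nat \<Rightarrow> real) \<Rightarrow> real" where
  "dotv n u v = (\<Sum>i\<in>{1..n}. u i * v i)"

definition sqnorm :: "nat \<Rightarrow> (nat \<Rightarrow> real) \<Rightarrow> real" where
  "sqnorm n u = dotv n u u"

definition lebR :: "nat \<Rightarrow> (nat \<Rightarrow> real) measure" where
  "lebR n = PiM {1..n} (\<lambda>_. lborel)"

definition W_measure :: "nat \<Rightarrow> nat \<Rightarrow> real \<Rightarrow> (nat \<Rightarrow> nat \<Rightarrow> real) measure" where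
  "W_measure n q s = PiM {1..q} (\<lambda>_. PiM {1..n} (\<lambda>_. density lborel (normal_density 0 s)))"

definition mix_density :: "nat \<Rightarrow> nat \<Rightarrow> real \<Rightarrow> (nat \<Rightarrow> nat \<Rightarrow> real) \<Rightarrow> (nat \<Rightarrow> real) \<Rightarrow> real" where
  "mix_density n q \<sigma> w x =
     (2 * pi * \<sigma>\<^sup>2) powr (- real n / 2) * (1 / real q) *
     (\<Sum>j\<in>{1..q}. exp (- sqnorm n (\<lambda>i. x i - w j i) / (2 * \<sigma>\<^sup>2)))"

definition diff_entropy :: "nat \<Rightarrow> ((nat \<Rightarrow> real) \<Rightarrow> real) \<Rightarrow> real" where
  "diff_entropy n f = - (\<integral>x. f x * ln (f x) \<partial>lebR n)"

definition cond_entropy :: "nat \<Rightarrow> nat \<Rightarrow> real \<Rightarrow> real \<Rightarrow> real" where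
  "cond_entropy n q \<sigma> s = (\<integral>w. diff_entropy n (mix_density n q \<sigma> w) \<partial>W_measure n q s)"

definition lam :: "nat \<Rightarrow> real \<Rightarrow> nat \<Rightarrow> real" where
  "lam q \<mu> j = (1/2) * ((\<mu> - 1) + (-1) ^ (j + 1) * sqrt (\<mu>\<^sup>2 - (4 / real q - 2) * \<mu> + 1))"

definition mj :: "nat \<Rightarrow> real \<Rightarrow> nat \<Rightarrow> real" where
  "mj q \<mu> j = lam q \<mu> j + 1"

definition xj :: "nat \<Rightarrow> real \<Rightarrow> nat \<Rightarrow> real" where
  "xj q \<mu> j = 1 - real q * mj q \<mu> j"

definition Nj :: "nat \<Rightarrow> real \<Rightarrow> nat \<Rightarrow> real" where
  "Nj q \<mu> j = real q - 1 + (xj q \<mu> j)\<^sup>2"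

definition alpha :: "nat \<Rightarrow> nat \<Rightarrow> real" where
  "alpha m l = (if l \<le> m then 1 / sqrt (real m * (real m + 1))
               else if l = m + 1 then - real m / sqrt (real m * (real m + 1))
               else 0)"

definition G_fun :: "nat \<Rightarrow> nat \<Rightarrow> real \<Rightarrow> (nat \<Rightarrow> nat \<Rightarrow> real) \<Rightarrow> nat \<Rightarrow> real" where
  "G_fun n q \<mu> u l =
     (\<Sum>m\<in>{1..q-2}. \<Sum>m'\<in>{1..q-2}. alpha m l * alpha m' l * dotv n (u m) (u m'))
     + 2 / sqrt (Nj q \<mu> 1) * (\<Sum>m\<in>{1..q-2}. alpha m l * dotv n (u m) (u (q-1)))
     + 2 / sqrt (Nj q \<mu> 2) * (\<Sum>m\<in>{1..q-2}. alpha m l * dotv n (u m) (u q))"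

definition T_fun :: "nat \<Rightarrow> nat \<Rightarrow> real \<Rightarrow> (nat \<Rightarrow> nat \<Rightarrow> real) \<Rightarrow> real" where
  "T_fun n q \<mu> u =
     ((xj q \<mu> 2)\<^sup>2 - 1) / (2 * Nj q \<mu> 2) * dotv n (u q) (u q)
     + ((xj q \<mu> 1)\<^sup>2 - 1) / (2 * Nj q \<mu> 1) * dotv n (u (q-1)) (u (q-1))
     + (xj q \<mu> 1 * xj q \<mu> 2 - 1) / (sqrt (Nj q \<mu> 1) * sqrt (Nj q \<mu> 2)) * dotv n (u q) (u (q-1))"

text \<open>d_k: u_{k,i} has variance 1/d_k.\<close>
definition dk :: "nat \<Rightarrow> real \<Rightarrow> nat \<Rightarrow> real" where
  "dk q \<mu> k = (if k \<le> q - 2 then 1 else if k = q - 1 then mj q \<mu> 1 else mj q \<mu> 2)"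

definition U_measure :: "nat \<Rightarrow> nat \<Rightarrow> real \<Rightarrow> (nat \<Rightarrow> nat \<Rightarrow> real) measure" where
  "U_measure n q \<mu> = PiM {1..q} (\<lambda>k. PiM {1..n}
      (\<lambda>_. density lborel (normal_density 0 (sqrt (1 / dk q \<mu> k)))))"

definition S_term :: "nat \<Rightarrow> nat \<Rightarrow> real \<Rightarrow> real" where
  "S_term n q \<mu> = - (\<integral>u. ln ((1 / real q) * (\<Sum>l\<in>{1..q}.
       exp (- (\<mu> / 2) * (G_fun n q \<mu> u l + 2 * (if l = q then 1 else 0) * T_fun n q \<mu> u))))
     \<partial>U_measure n q \<mu>)"

end

theory Submission
  imports Defs
begin

text \<open>Conditionally on the component \<open>j\<close> that generated \<open>X\<close>, write \<open>X = W\<^sub>j - \<sigma> Z\<close>; by exchangeability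
  \<open>j = q\<close>. The entropy is then, up to a constant, the expectation of
  \<open>- ln (1/q \<Sum>\<^sub>l exp (- \<bar>Z + \<surd>\<mu> (Y\<^sub>l - Y\<^sub>q)\<bar>\<^sup>2 / 2))\<close> over \<open>q + 1\<close> independent standard Gaussian vectors
  \<open>Z, Y\<^sub>1, \<dots>, Y\<^sub>q\<close>. Helmert's orthogonal transformation of \<open>Y\<^sub>1, \<dots>, Y\<^sub>q\<close> eliminates their mean, and with
  \<open>h\<close> the last remaining Helmert vector, \<open>\<kappa> = \<surd>(q / (q - 1))\<close>, \<open>D = Z / \<surd>\<mu>\<close> and \<open>c = D + \<kappa> h\<close>, the exponents
  become \<open>- \<mu> / 2 \<bar>c + \<Sum>\<^sub>m \<alpha>\<^sub>m\<^sub>l u\<^sub>m\<bar>\<^sup>2\<close> for \<open>l < q\<close> and \<open>- \<mu> / 2 \<bar>D\<bar>\<^sup>2\<close> for \<open>l = q\<close>. A last rotation, of \<open>h\<close> and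
  \<open>Z\<close>, turns \<open>c\<close> and \<open>D\<close> into the combinations of \<open>u\<^sub>q\<^sub>-\<^sub>1\<close> and \<open>u\<^sub>q\<close> that occur in \<open>G\<close> and \<open>T\<close>. Pulling
  \<open>exp (- \<mu> / 2 \<bar>c\<bar>\<^sup>2)\<close> out of the sum leaves the exponents of \<open>S\<close> and contributes
  \<open>\<mu> / 2 E \<bar>c\<bar>\<^sup>2 = n / 2 (1 + \<mu> q / (q - 1))\<close>.

  Both Helmert's transformation and the last rotation are products of plane rotations, so the only
  invariance needed is that of independent Gaussian vectors under a rotation in two slots.\<close>

section \<open>Products of Gaussian measures\<close>

text \<open>The preimage of a box under a componentwise map is the box of the preimages, and a
  finite product of probability measures is determined by its values on boxes.\<close>

lemma distr_PiM_componentwise: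
  assumes I: "finite I" and M: "\<And>i. prob_space (M i)"
    and f [measurable]: "\<And>i. f i \<in> measurable (M i) (M' i)"
  shows "distr (PiM I M) (PiM I M') (\<lambda>\<omega>. \<lambda>i\<in>I. f i (\<omega> i)) = PiM I (\<lambda>i. distr (M i) (M' i) (f i))"
proof -
  interpret P: product_prob_space M I
    by (intro product_prob_spaceI M)
  interpret D: product_prob_space "\<lambda>i. distr (M i) (M' i) (f i)" I
    by (intro product_prob_spaceI prob_space.prob_space_distr M f)
  show ?thesis
  proof (rule D.PiM_eqI[OF I])
    show "sets (distr (PiM I M) (PiM I M') (\<lambda>\<omega>. \<lambda>i\<in>I. f i (\<omega> i)))
        = sets (PiM I (\<lambda>i. distr (M i) (M' i) (f i)))"
      unfolding sets_distr by (intro sets_PiM_cong) auto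
    fix A assume A: "\<And>i. i \<in> I \<Longrightarrow> A i \<in> sets (distr (M i) (M' i) (f i))"
    have eq: "(\<lambda>\<omega>. \<lambda>i\<in>I. f i (\<omega> i)) -` Pi\<^sub>E I A \<inter> space (PiM I M)
        = Pi\<^sub>E I (\<lambda>i. f i -` A i \<inter> space (M i))"
      by (auto simp: space_PiM PiE_iff)
    have "emeasure (distr (PiM I M) (PiM I M') (\<lambda>\<omega>. \<lambda>i\<in>I. f i (\<omega> i))) (Pi\<^sub>E I A)
        = emeasure (PiM I M) (Pi\<^sub>E I (\<lambda>i. f i -` A i \<inter> space (M i)))"
      using A I by (subst emeasure_distr) (auto simp: eq intro!: sets_PiM_I_finite measurable_restrict)
    also have "\<dots> = (\<Prod>i\<in>I. emeasure (M i) (f i -` A i \<inter> space (M i)))"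
      using A by (intro P.emeasure_PiM[OF I]) (auto intro!: measurable_sets)
    also have "\<dots> = (\<Prod>i\<in>I. emeasure (distr (M i) (M' i) (f i)) (A i))"
      using A by (intro prod.cong refl) (auto simp: emeasure_distr)
    finally show "emeasure (distr (PiM I M) (PiM I M') (\<lambda>\<omega>. \<lambda>i\<in>I. f i (\<omega> i))) (Pi\<^sub>E I A)
        = (\<Prod>i\<in>I. emeasure (distr (M i) (M' i) (f i)) (A i))" .
  qed
qed

text \<open>Again tested on boxes: the indicator of a box is the product of the indicators of its
  sides, so the integral of the product density over it factorises.\<close>

lemma PiM_density_lborel:
  fixes g :: "'i \<Rightarrow> real \<Rightarrow> ennreal"
  assumes I: "finite I" and g [measurable]: "\<And>i. g i \<in> borel_measurable borel"
    and pr: "\<And>i. prob_space (density lborel (g i))"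
  shows "PiM I (\<lambda>i. density lborel (g i)) = density (PiM I (\<lambda>_. lborel)) (\<lambda>x. \<Prod>i\<in>I. g i (x i))"
proof -
  interpret D: product_prob_space "\<lambda>i. density lborel (g i)" I
    by (intro product_prob_spaceI pr)
  interpret L: product_sigma_finite "\<lambda>_. lborel :: real measure"
    by standard
  have s: "sets (PiM I (\<lambda>i. density lborel (g i))) = sets (PiM I (\<lambda>_. lborel))"
    by (intro sets_PiM_cong) auto
  show ?thesis
  proof (rule D.PiM_eqI[OF I, symmetric])
    show "sets (density (PiM I (\<lambda>_. lborel)) (\<lambda>x. \<Prod>i\<in>I. g i (x i)))
        = sets (PiM I (\<lambda>i. density lborel (g i)))"
      using s by simp
    fix A assume A: "\<And>i. i \<in> I \<Longrightarrow> A i \<in> sets (density lborel (g i))"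
    then have A': "\<And>i. i \<in> I \<Longrightarrow> A i \<in> sets borel" by simp
    have box: "Pi\<^sub>E I A \<in> sets (PiM I (\<lambda>_. lborel))"
      using A' I by (intro sets_PiM_I_finite) auto
    have "emeasure (density (PiM I (\<lambda>_. lborel)) (\<lambda>x. \<Prod>i\<in>I. g i (x i))) (Pi\<^sub>E I A)
        = (\<integral>\<^sup>+x. (\<Prod>i\<in>I. g i (x i)) * indicator (Pi\<^sub>E I A) x \<partial>PiM I (\<lambda>_. lborel))"
      using I by (intro emeasure_density box) measurable
    also have "\<dots> = (\<integral>\<^sup>+x. (\<Prod>i\<in>I. g i (x i) * indicator (A i) (x i)) \<partial>PiM I (\<lambda>_. lborel))"
      using I by (intro nn_integral_cong)
        (auto simp: prod.distrib indicator_def space_PiM PiE_iff)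
    also have "\<dots> = (\<Prod>i\<in>I. \<integral>\<^sup>+x. g i x * indicator (A i) x \<partial>lborel)"
      using A' by (intro L.product_nn_integral_prod[OF I]) auto
    also have "\<dots> = (\<Prod>i\<in>I. emeasure (density lborel (g i)) (A i))"
      using A' by (intro prod.cong refl) (auto simp: emeasure_density)
    finally show "emeasure (density (PiM I (\<lambda>_. lborel)) (\<lambda>x. \<Prod>i\<in>I. g i (x i))) (Pi\<^sub>E I A)
        = (\<Prod>i\<in>I. emeasure (density lborel (g i)) (A i))" .
  qed
qed

section \<open>Shears and rotations under Lebesgue and Gaussian measure\<close>

lemma lborel_shear_fst:
  fixes g :: "real \<times> real \<Rightarrow> ennreal"
  assumes [measurable]: "g \<in> borel_measurable (borel \<Otimes>\<^sub>M borel)"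
  shows "(\<integral>\<^sup>+y. \<integral>\<^sup>+x. g (x + t * y, y) \<partial>lborel \<partial>lborel) = (\<integral>\<^sup>+y. \<integral>\<^sup>+x. g (x, y) \<partial>lborel \<partial>lborel)"
proof (rule nn_integral_cong)
  fix y :: real
  show "(\<integral>\<^sup>+x. g (x + t * y, y) \<partial>lborel) = (\<integral>\<^sup>+x. g (x, y) \<partial>lborel)"
    \<comment> \<open>For fixed \<open>y\<close> the shear is a translation of
      \<open>x\<close>.\<close>
    using nn_integral_real_affine[of "\<lambda>x. g (x, y)" 1 "t * y"] by (simp add: add.commute)
qed

lemma lborel_shear_snd:
  fixes g :: "real \<times> real \<Rightarrow> ennreal"
  assumes [measurable]: "g \<in> borel_measurable (borel \<Otimes>\<^sub>M borel)"
  shows "(\<integral>\<^sup>+y. \<integral>\<^sup>+x. g (x, y + t * x) \<partial>lborel \<partial>lborel) = (\<integral>\<^sup>+y. \<integral>\<^sup>+x. g (x, y) \<partial>lborel \<partial>lborel)"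
proof -
  have "(\<integral>\<^sup>+y. \<integral>\<^sup>+x. g (x, y + t * x) \<partial>lborel \<partial>lborel) = (\<integral>\<^sup>+x. \<integral>\<^sup>+y. g (x, y + t * x) \<partial>lborel \<partial>lborel)"
    by (rule lborel_pair.Fubini') measurable
  also have "\<dots> = (\<integral>\<^sup>+x. \<integral>\<^sup>+y. g (x, y) \<partial>lborel \<partial>lborel)"
    using lborel_shear_fst[of "\<lambda>p. g (snd p, fst p)" t] by simp
  also have "\<dots> = (\<integral>\<^sup>+y. \<integral>\<^sup>+x. g (x, y) \<partial>lborel \<partial>lborel)"
    by (rule lborel_pair.Fubini'[symmetric]) measurable
  finally show ?thesis .
qed

text \<open>A rotation by an angle that is not a multiple of \<open>\<pi>\<close> is a product of three shears.\<close>
lemma lborel_rotation: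
  fixes g :: "real \<times> real \<Rightarrow> ennreal"
  assumes [measurable]: "g \<in> borel_measurable (borel \<Otimes>\<^sub>M borel)" and ab: "a\<^sup>2 + b\<^sup>2 = (1::real)" "b \<noteq> 0"
  shows "(\<integral>\<^sup>+y. \<integral>\<^sup>+x. g (a * x - b * y, b * x + a * y) \<partial>lborel \<partial>lborel)
    = (\<integral>\<^sup>+y. \<integral>\<^sup>+x. g (x, y) \<partial>lborel \<partial>lborel)"
proof -
  \<comment> \<open>With \<open>a\<close> and \<open>b\<close> the cosine and sine of an angle,
    \<open>t\<close> is minus the tangent of half that angle; the shears are by \<open>t\<close> in
    \<open>x\<close>, then by \<open>b\<close> in \<open>y\<close>, then by \<open>t\<close> in
    \<open>x\<close> again.\<close>
  define t where "t = (a - 1) / b"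
  have tb: "t * b = a - 1" using ab by (simp add: t_def)
  have t2: "t * (a + 1) = - b"
  proof -
    have "t * (a + 1) = (a\<^sup>2 - 1) / b" by (simp add: t_def power2_eq_square algebra_simps)
    also have "a\<^sup>2 - 1 = - b\<^sup>2" using ab by simp
    finally show ?thesis using ab by (simp add: power2_eq_square)
  qed
  \<comment> \<open>\<open>g1\<close> absorbs the last shear and \<open>g2\<close> the middle one as
    well, so the three shears can be removed one at a time.\<close>
  define g1 where "g1 p = g (fst p + t * snd p, snd p)" for p
  define g2 where "g2 p = g1 (fst p, snd p + b * fst p)" for p
  have [measurable]: "g1 \<in> borel_measurable (borel \<Otimes>\<^sub>M borel)"
    unfolding g1_def by measurable
  have [measurable]: "g2 \<in> borel_measurable (borel \<Otimes>\<^sub>M borel)"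
    unfolding g2_def by measurable
  have "g (a * x - b * y, b * x + a * y) = g2 (x + t * y, y)" for x y
  proof -
    have "x + t * y + t * (y + b * (x + t * y)) = (1 + t * b) * x + (t * (2 + t * b)) * y"
      by (simp add: algebra_simps)
    also have "\<dots> = a * x - b * y" using tb t2 by (simp add: add.commute)
    finally have "x + t * y + t * (y + b * (x + t * y)) = a * x - b * y" .
    moreover have "y + b * (x + t * y) = b * x + (1 + t * b) * y" by (simp add: algebra_simps)
    ultimately show ?thesis unfolding g1_def g2_def using tb by simp
  qed
  then show ?thesis
    using lborel_shear_fst[of g2 t] lborel_shear_snd[of g1 b] lborel_shear_fst[of g t]
    by (simp add: g1_def g2_def)
qed

abbreviation std_gauss :: "real measure" where
  "std_gauss \<equiv> density lborel (normal_density 0 1)"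

lemma prob_space_std_gauss: "prob_space std_gauss"
  by (intro prob_space_normal_density) simp

text \<open>The joint density depends on the point only through
  \<open>x\<^sup>2 + y\<^sup>2\<close>, so its argument may be rotated too, and the invariance of
  Lebesgue measure applies to the product of the density and \<open>g\<close>.\<close>

lemma std_gauss_rotation:
  fixes g :: "real \<times> real \<Rightarrow> ennreal"
  assumes [measurable]: "g \<in> borel_measurable (borel \<Otimes>\<^sub>M borel)" and ab: "a\<^sup>2 + b\<^sup>2 = (1::real)" "b \<noteq> 0"
  shows "(\<integral>\<^sup>+y. \<integral>\<^sup>+x. g (a * x - b * y, b * x + a * y) \<partial>std_gauss \<partial>std_gauss)
    = (\<integral>\<^sup>+y. \<integral>\<^sup>+x. g (x, y) \<partial>std_gauss \<partial>std_gauss)"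
proof -
  define \<phi> where "\<phi> p = ennreal (std_normal_density (fst p) * std_normal_density (snd p))" for p :: "real \<times> real"
  have [measurable]: "\<phi> \<in> borel_measurable (borel \<Otimes>\<^sub>M borel)"
    unfolding \<phi>_def by measurable
  have dens: "(\<integral>\<^sup>+y. \<integral>\<^sup>+x. h (x, y) \<partial>std_gauss \<partial>std_gauss) = (\<integral>\<^sup>+y. \<integral>\<^sup>+x. \<phi> (x, y) * h (x, y) \<partial>lborel \<partial>lborel)"
    if [measurable]: "h \<in> borel_measurable (borel \<Otimes>\<^sub>M borel)" for h :: "real \<times> real \<Rightarrow> ennreal"
    by (simp add: nn_integral_density nn_integral_cmult[symmetric] \<phi>_def ennreal_mult' mult_ac)
  have inv: "\<phi> (a * x - b * y, b * x + a * y) = \<phi> (x, y)" for x y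
  proof -
    have "(a * x - b * y)\<^sup>2 + (b * x + a * y)\<^sup>2 = (a\<^sup>2 + b\<^sup>2) * (x\<^sup>2 + y\<^sup>2)"
      by (simp add: power2_eq_square algebra_simps)
    then have "(a * x - b * y)\<^sup>2 + (b * x + a * y)\<^sup>2 = x\<^sup>2 + y\<^sup>2" using ab by simp
    then have "- (a * x - b * y)\<^sup>2 / 2 + - (b * x + a * y)\<^sup>2 / 2 = - x\<^sup>2 / 2 + - y\<^sup>2 / 2"
      by linarith
    then have "exp (- (a * x - b * y)\<^sup>2 / 2) * exp (- (b * x + a * y)\<^sup>2 / 2) = exp (- x\<^sup>2 / 2) * exp (- y\<^sup>2 / 2)"
      unfolding exp_add[symmetric] by simp
    then have "std_normal_density (a * x - b * y) * std_normal_density (b * x + a * y)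
      = std_normal_density x * std_normal_density y"
      by (simp add: normal_density_def power2_eq_square)
    then show ?thesis by (simp add: \<phi>_def)
  qed
  have "(\<integral>\<^sup>+y. \<integral>\<^sup>+x. g (a * x - b * y, b * x + a * y) \<partial>std_gauss \<partial>std_gauss)
    = (\<integral>\<^sup>+y. \<integral>\<^sup>+x. \<phi> (x, y) * g (a * x - b * y, b * x + a * y) \<partial>lborel \<partial>lborel)"
    using dens[of "\<lambda>p. g (a * fst p - b * snd p, b * fst p + a * snd p)"] by simp
  also have "\<dots> = (\<integral>\<^sup>+y. \<integral>\<^sup>+x. \<phi> (a * x - b * y, b * x + a * y) * g (a * x - b * y, b * x + a * y) \<partial>lborel \<partial>lborel)"
    by (simp add: inv)
  also have "\<dots> = (\<integral>\<^sup>+y. \<integral>\<^sup>+x. \<phi> (x, y) * g (x, y) \<partial>lborel \<partial>lborel)"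
    using ab by (intro lborel_rotation[of "\<lambda>p. \<phi> p * g p"]) auto
  also have "\<dots> = (\<integral>\<^sup>+y. \<integral>\<^sup>+x. g (x, y) \<partial>std_gauss \<partial>std_gauss)"
    using dens[of g] by simp
  finally show ?thesis .
qed

text \<open>Brings the \<open>i\<close>-th coordinates of both vectors to the two innermost
  integrals, where they can be rotated as a pair while all other coordinates are fixed.\<close>

lemma nn_integral_pair_PiM_insert:
  fixes g :: "('i \<Rightarrow> real) \<times> ('i \<Rightarrow> real) \<Rightarrow> ennreal"
  assumes J: "finite J" "i \<notin> J"
    and [measurable]: "g \<in> borel_measurable (PiM (insert i J) (\<lambda>_. std_gauss) \<Otimes>\<^sub>M PiM (insert i J) (\<lambda>_. std_gauss))"
  shows "(\<integral>\<^sup>+y. \<integral>\<^sup>+x. g (x, y) \<partial>PiM (insert i J) (\<lambda>_. std_gauss) \<partial>PiM (insert i J) (\<lambda>_. std_gauss))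
    = (\<integral>\<^sup>+y. \<integral>\<^sup>+x. \<integral>\<^sup>+t. \<integral>\<^sup>+r. g (x(i := r), y(i := t)) \<partial>std_gauss \<partial>std_gauss
        \<partial>PiM J (\<lambda>_. std_gauss) \<partial>PiM J (\<lambda>_. std_gauss))"
proof -
  interpret N: prob_space std_gauss by (rule prob_space_std_gauss)
  interpret P: product_prob_space "\<lambda>_::'i. std_gauss" J
    by (intro product_prob_spaceI prob_space_std_gauss)
  interpret E: prob_space "PiM J (\<lambda>_. std_gauss)"
    by (intro prob_space_PiM prob_space_std_gauss)
  interpret EI: prob_space "PiM (insert i J) (\<lambda>_. std_gauss)"
    by (intro prob_space_PiM prob_space_std_gauss)
  interpret EN: pair_sigma_finite "PiM J (\<lambda>_. std_gauss)" std_gauss ..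
  have "(\<integral>\<^sup>+y. \<integral>\<^sup>+x. g (x, y) \<partial>PiM (insert i J) (\<lambda>_. std_gauss) \<partial>PiM (insert i J) (\<lambda>_. std_gauss))
    = (\<integral>\<^sup>+y. \<integral>\<^sup>+t. \<integral>\<^sup>+x. g (x, y(i := t)) \<partial>PiM (insert i J) (\<lambda>_. std_gauss) \<partial>std_gauss \<partial>PiM J (\<lambda>_. std_gauss))"
    using J by (intro P.product_nn_integral_insert) measurable
  also have "\<dots> = (\<integral>\<^sup>+y. \<integral>\<^sup>+t. \<integral>\<^sup>+x. \<integral>\<^sup>+r. g (x(i := r), y(i := t)) \<partial>std_gauss \<partial>PiM J (\<lambda>_. std_gauss) \<partial>std_gauss \<partial>PiM J (\<lambda>_. std_gauss))"
    using J by (intro nn_integral_cong P.product_nn_integral_insert) measurable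
  also have "\<dots> = (\<integral>\<^sup>+y. \<integral>\<^sup>+x. \<integral>\<^sup>+t. \<integral>\<^sup>+r. g (x(i := r), y(i := t)) \<partial>std_gauss \<partial>std_gauss \<partial>PiM J (\<lambda>_. std_gauss) \<partial>PiM J (\<lambda>_. std_gauss))"
    by (intro nn_integral_cong EN.Fubini') measurable
  finally show ?thesis .
qed

text \<open>Induction on \<open>I\<close>: the pair of new coordinates is rotated in the plane for
  fixed remaining coordinates; the induction hypothesis is then applied to the function obtained
  from \<open>g\<close> by integrating that pair out.\<close>

lemma PiM_std_gauss_rotation:
  fixes g :: "('i \<Rightarrow> real) \<times> ('i \<Rightarrow> real) \<Rightarrow> ennreal"
  assumes I: "finite I" and ab: "a\<^sup>2 + b\<^sup>2 = (1::real)" "b \<noteq> 0"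
    and g: "g \<in> borel_measurable (PiM I (\<lambda>_. std_gauss) \<Otimes>\<^sub>M PiM I (\<lambda>_. std_gauss))"
  shows "(\<integral>\<^sup>+y. \<integral>\<^sup>+x. g (\<lambda>i\<in>I. a * x i - b * y i, \<lambda>i\<in>I. b * x i + a * y i)
        \<partial>PiM I (\<lambda>_. std_gauss) \<partial>PiM I (\<lambda>_. std_gauss))
    = (\<integral>\<^sup>+y. \<integral>\<^sup>+x. g (x, y) \<partial>PiM I (\<lambda>_. std_gauss) \<partial>PiM I (\<lambda>_. std_gauss))"
  using I g
proof (induction I arbitrary: g)
  case empty
  \<comment> \<open>The product over the empty set has a single point, so both sides evaluate
    \<open>g\<close> at the same argument.\<close>
  show ?case
    by (intro nn_integral_cong) (auto simp: space_PiM restrict_def intro!: arg_cong[of _ _ g])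
next
  case (insert i J)
  note [measurable] = insert.prems
  let ?E = "PiM J (\<lambda>_. std_gauss)" and ?EI = "PiM (insert i J) (\<lambda>_. std_gauss)"
  let ?X = "\<lambda>I x y. \<lambda>i\<in>I. a * x i - b * y i" and ?Y = "\<lambda>I x y. \<lambda>i\<in>I. b * x i + a * y i"
  interpret N: prob_space std_gauss by (rule prob_space_std_gauss)
  have upd: "?X (insert i J) (x(i := r)) (y(i := t)) = (?X J x y)(i := a * r - b * t)"
     "?Y (insert i J) (x(i := r)) (y(i := t)) = (?Y J x y)(i := b * r + a * t)" for x y r t
    using insert.hyps by (auto simp: restrict_def)
  have "(\<integral>\<^sup>+y. \<integral>\<^sup>+x. g (?X (insert i J) x y, ?Y (insert i J) x y) \<partial>?EI \<partial>?EI)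
    = (\<integral>\<^sup>+y. \<integral>\<^sup>+x. \<integral>\<^sup>+t. \<integral>\<^sup>+r. g ((?X J x y)(i := a * r - b * t), (?Y J x y)(i := b * r + a * t))
        \<partial>std_gauss \<partial>std_gauss \<partial>?E \<partial>?E)"
    using nn_integral_pair_PiM_insert[OF insert.hyps,
      of "\<lambda>p. g (?X (insert i J) (fst p) (snd p), ?Y (insert i J) (fst p) (snd p))"]
    by (simp only: fst_conv snd_conv upd) measurable
  also have "\<dots> = (\<integral>\<^sup>+y. \<integral>\<^sup>+x. \<integral>\<^sup>+t. \<integral>\<^sup>+r. g ((?X J x y)(i := r), (?Y J x y)(i := t))
        \<partial>std_gauss \<partial>std_gauss \<partial>?E \<partial>?E)"
  proof (rule nn_integral_cong, rule nn_integral_cong)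
    fix x y
    have [measurable]: "?X J x y \<in> space ?E" "?Y J x y \<in> space ?E"
      by (auto simp: space_PiM)
    show "(\<integral>\<^sup>+t. \<integral>\<^sup>+r. g ((?X J x y)(i := a * r - b * t), (?Y J x y)(i := b * r + a * t)) \<partial>std_gauss \<partial>std_gauss)
       = (\<integral>\<^sup>+t. \<integral>\<^sup>+r. g ((?X J x y)(i := r), (?Y J x y)(i := t)) \<partial>std_gauss \<partial>std_gauss)"
      using std_gauss_rotation[of "\<lambda>p. g ((?X J x y)(i := fst p), (?Y J x y)(i := snd p))" a b] ab
      by (simp only: fst_conv snd_conv) measurable
  qed
  also have "\<dots> = (\<integral>\<^sup>+y. \<integral>\<^sup>+x. \<integral>\<^sup>+t. \<integral>\<^sup>+r. g (x(i := r), y(i := t)) \<partial>std_gauss \<partial>std_gauss \<partial>?E \<partial>?E)"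
    using insert.IH[of "\<lambda>p. \<integral>\<^sup>+t. \<integral>\<^sup>+r. g ((fst p)(i := r), (snd p)(i := t)) \<partial>std_gauss \<partial>std_gauss"]
    by (simp only: fst_conv snd_conv) measurable
  also have "\<dots> = (\<integral>\<^sup>+y. \<integral>\<^sup>+x. g (x, y) \<partial>?EI \<partial>?EI)"
    by (rule nn_integral_pair_PiM_insert[OF insert.hyps, symmetric]) measurable
  finally show ?case .
qed

text \<open>The restriction to \<open>I\<close> keeps the new vectors extensional, as points of a
  product over \<open>I\<close> have to be.\<close>

definition rot_slots :: "'i set \<Rightarrow> real \<Rightarrow> real \<Rightarrow> 'k \<Rightarrow> 'k \<Rightarrow> ('k \<Rightarrow> 'i \<Rightarrow> real) \<Rightarrow> 'k \<Rightarrow> 'i \<Rightarrow> real" where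
  "rot_slots I a b p r w = w(p := (\<lambda>i\<in>I. a * w p i - b * w r i), r := (\<lambda>i\<in>I. b * w p i + a * w r i))"

abbreviation gauss_tuple :: "'k set \<Rightarrow> 'i set \<Rightarrow> ('k \<Rightarrow> 'i \<Rightarrow> real) measure" where
  "gauss_tuple K I \<equiv> PiM K (\<lambda>_. PiM I (\<lambda>_. std_gauss))"

lemma measurable_gauss_tuple_coord:
  assumes "k \<in> K" "i \<in> I"
  shows "(\<lambda>w. w k i) \<in> borel_measurable (gauss_tuple K I)"
  using measurable_compose[OF measurable_component_singleton[OF assms(1), of "\<lambda>_. PiM I (\<lambda>_. std_gauss)"]
      measurable_component_singleton[OF assms(2)]] by simp

lemma measurable_rot_slots:
  assumes "finite I" "p \<in> K" "r \<in> K" "p \<noteq> r"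
  shows "rot_slots I a b p r \<in> measurable (gauss_tuple K I) (gauss_tuple K I)"
proof -
  \<comment> \<open>Updating a slot adds its index to the index set of the product; in this form the
    addition changes nothing.\<close>
  have K: "K = insert r (insert p K)" using assms by auto
  have [measurable]: "(\<lambda>w. w p i) \<in> borel_measurable (gauss_tuple K I)"
    "(\<lambda>w. w r i) \<in> borel_measurable (gauss_tuple K I)" if "i \<in> I" for i
    using that assms by (simp_all add: measurable_gauss_tuple_coord)
  have [measurable]: "(\<lambda>w. \<lambda>i\<in>I. a * w p i - b * w r i) \<in> measurable (gauss_tuple K I) (PiM I (\<lambda>_. std_gauss))"
    "(\<lambda>w. \<lambda>i\<in>I. b * w p i + a * w r i) \<in> measurable (gauss_tuple K I) (PiM I (\<lambda>_. std_gauss))"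
    by (auto intro!: measurable_restrict)
  have "(\<lambda>w. w(p := (\<lambda>i\<in>I. a * w p i - b * w r i), r := (\<lambda>i\<in>I. b * w p i + a * w r i)))
     \<in> measurable (gauss_tuple K I) (gauss_tuple (insert r (insert p K)) I)"
    using assms by measurable
  then show ?thesis unfolding rot_slots_def[abs_def] K[symmetric] .
qed

text \<open>By Fubini all slots except \<open>p\<close> and \<open>r\<close> may be fixed; the claim
  for the indicator of a measurable set is then the rotation invariance of a pair of Gaussian
  vectors.\<close>

lemma distr_rot_slots:
  assumes I: "finite I" and K: "finite K" "p \<in> K" "r \<in> K" "p \<noteq> r" and ab: "a\<^sup>2 + b\<^sup>2 = (1::real)" "b \<noteq> 0"
  shows "distr (gauss_tuple K I) (gauss_tuple K I) (rot_slots I a b p r) = gauss_tuple K I"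
proof (rule measure_eqI)
  let ?G = "gauss_tuple K I" and ?E = "PiM I (\<lambda>_. std_gauss)"
  interpret E: prob_space ?E
    by (intro prob_space_PiM prob_space_std_gauss)
  interpret P: product_prob_space "\<lambda>_. ?E" K
    by (intro product_prob_spaceI E.prob_space_axioms)
  note [measurable] = measurable_rot_slots[OF I K(2-4), of a b]
  define J where "J = K - {p, r}"
  have J: "finite J" "p \<notin> insert r J" "r \<notin> J" "K = insert p (insert r J)"
    using K by (auto simp: J_def)
  fix A assume "A \<in> sets (distr ?G ?G (rot_slots I a b p r))"
  then have A [measurable]: "A \<in> sets ?G" by simp
  have split: "(\<integral>\<^sup>+w. f w \<partial>?G) = (\<integral>\<^sup>+w. \<integral>\<^sup>+y. \<integral>\<^sup>+x. f (w(r := y, p := x)) \<partial>?E \<partial>?E \<partial>gauss_tuple J I)"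
    if f: "f \<in> borel_measurable ?G" for f
  proof -
    have f' [measurable]: "f \<in> borel_measurable (gauss_tuple (insert p (insert r J)) I)"
      using f unfolding J(4) .
    have "(\<integral>\<^sup>+w. f w \<partial>?G) = (\<integral>\<^sup>+w. \<integral>\<^sup>+x. f (w(p := x)) \<partial>?E \<partial>gauss_tuple (insert r J) I)"
      unfolding J(4) using J(1-3) by (intro P.product_nn_integral_insert f') auto
    also have "\<dots> = (\<integral>\<^sup>+w. \<integral>\<^sup>+y. \<integral>\<^sup>+x. f (w(r := y, p := x)) \<partial>?E \<partial>?E \<partial>gauss_tuple J I)"
      using J(1-3) by (intro P.product_nn_integral_insert) auto
    finally show ?thesis .
  qed
  define g :: "_ \<Rightarrow> ennreal" where "g = indicator A"
  have g [measurable]: "g \<in> borel_measurable ?G" unfolding g_def by measurable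
  have "emeasure (distr ?G ?G (rot_slots I a b p r)) A = (\<integral>\<^sup>+w. g w \<partial>distr ?G ?G (rot_slots I a b p r))"
    by (simp add: g_def)
  also have "\<dots> = (\<integral>\<^sup>+w. g (rot_slots I a b p r w) \<partial>?G)"
    by (intro nn_integral_distr) measurable
  also have "\<dots> = (\<integral>\<^sup>+w. \<integral>\<^sup>+y. \<integral>\<^sup>+x. g (w(r := (\<lambda>i\<in>I. b * x i + a * y i), p := (\<lambda>i\<in>I. a * x i - b * y i)))
      \<partial>?E \<partial>?E \<partial>gauss_tuple J I)"
    using K(4) measurable_compose[OF measurable_rot_slots[OF I K(2-4)] g]
    by (subst split) (auto simp: rot_slots_def fun_upd_twist intro!: nn_integral_cong arg_cong[of _ _ g])
  also have "\<dots> = (\<integral>\<^sup>+w. \<integral>\<^sup>+y. \<integral>\<^sup>+x. g (w(r := y, p := x)) \<partial>?E \<partial>?E \<partial>gauss_tuple J I)"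
  proof (rule nn_integral_cong)
    fix w assume [measurable]: "w \<in> space (gauss_tuple J I)"
    have g' [measurable]: "g \<in> borel_measurable (gauss_tuple (insert p (insert r J)) I)"
      using g unfolding J(4) .
    show "(\<integral>\<^sup>+y. \<integral>\<^sup>+x. g (w(r := (\<lambda>i\<in>I. b * x i + a * y i), p := (\<lambda>i\<in>I. a * x i - b * y i))) \<partial>?E \<partial>?E)
      = (\<integral>\<^sup>+y. \<integral>\<^sup>+x. g (w(r := y, p := x)) \<partial>?E \<partial>?E)"
      using PiM_std_gauss_rotation[OF I ab, of "\<lambda>z. g (w(r := snd z, p := fst z))"]
      by (simp only: fst_conv snd_conv) measurable
  qed
  also have "\<dots> = (\<integral>\<^sup>+w. g w \<partial>?G)" by (rule split[OF g, symmetric])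
  also have "\<dots> = emeasure ?G A" by (simp add: g_def)
  finally show "emeasure (distr ?G ?G (rot_slots I a b p r)) A = emeasure ?G A" .
qed simp

section \<open>The Helmert transformation\<close>

text \<open>Slots \<open>1, \<dots>, k - 1\<close> of the argument hold the Helmert contrasts of the first \<open>k\<close> vectors of the result, slot
  \<open>k\<close> their sum divided by \<open>\<surd>k\<close>.\<close>
definition helmert_inv :: "'i set \<Rightarrow> nat \<Rightarrow> (nat \<Rightarrow> 'i \<Rightarrow> real) \<Rightarrow> nat \<Rightarrow> 'i \<Rightarrow> real" where
  "helmert_inv I k w l = (if 1 \<le> l \<and> l \<le> k
     then (\<lambda>i\<in>I. (\<Sum>m\<in>{1..<k}. alpha m l * w m i) + w k i / sqrt (real k)) else w l)"

text \<open>One plane rotation turns contrast \<open>k\<close> and the normalised sum of the first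
  \<open>k + 1\<close> vectors into the normalised sum of the first \<open>k\<close> vectors and
  vector \<open>k + 1\<close> itself.\<close>

lemma helmert_inv_Suc:
  assumes "1 \<le> k"
  shows "helmert_inv I (Suc k) w
    = helmert_inv I k (rot_slots I (1 / sqrt (real (Suc k))) (- sqrt (real k) / sqrt (real (Suc k))) k (Suc k) w)"
proof (rule ext)
  fix l
  have k: "real k > 0" using assms by simp
  consider "l < 1" | "1 \<le> l" "l \<le> k" | "l = Suc k" | "l > Suc k" by linarith
  then show "helmert_inv I (Suc k) w l
    = helmert_inv I k (rot_slots I (1 / sqrt (real (Suc k))) (- sqrt (real k) / sqrt (real (Suc k))) k (Suc k) w) l"
  proof cases
    case 2
    \<comment> \<open>For \<open>l \<le> k\<close> both summands come from slot \<open>k\<close> of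
      the rotated tuple after its division by \<open>sqrt k\<close>.\<close>
    have "alpha k l * x + y / sqrt (real (Suc k))
      = (x / sqrt (real (Suc k)) + sqrt (real k) * y / sqrt (real (Suc k))) / sqrt (real k)" for x y
      using k 2 by (simp add: alpha_def real_sqrt_mult add_divide_distrib add.commute mult.commute)
    then show ?thesis using 2 assms
      by (auto simp: helmert_inv_def rot_slots_def intro!: restrict_ext)
  next
    case 3
    have "alpha k l = - (sqrt (real k) * sqrt (real k)) / (sqrt (real k) * sqrt (real (Suc k)))"
      using 3 by (simp add: alpha_def real_sqrt_mult add.commute)
    also have "\<dots> = - sqrt (real k) / sqrt (real (Suc k))"
      using k by (simp del: real_sqrt_mult_self)
    finally have "alpha k l = - sqrt (real k) / sqrt (real (Suc k))" .
    \<comment> \<open>Vector \<open>k + 1\<close> enters none of the earlier contrasts, so it is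
      given by the rotation alone.\<close>
    moreover have "alpha m l = 0" if "m < k" for m
      using that 3 by (simp add: alpha_def)
    ultimately show ?thesis using 3 assms
      by (auto simp: helmert_inv_def rot_slots_def intro!: restrict_ext)
  qed (use k in \<open>auto simp: helmert_inv_def rot_slots_def\<close>)
qed

text \<open>Peeling off one vector at a time gives a composition of plane rotations. Measurability
  is part of the induction because composing image laws requires it.\<close>

lemma distr_helmert_inv:
  assumes I: "finite I" and K: "finite K" and k: "1 \<le> k" "{1..k} \<subseteq> K"
  shows "helmert_inv I k \<in> measurable (gauss_tuple K I) (gauss_tuple K I)
    \<and> distr (gauss_tuple K I) (gauss_tuple K I) (helmert_inv I k) = gauss_tuple K I"
  using k
proof (induction k rule: nat_induct_at_least)
  case base
  have 1: "1 \<in> K" using base by auto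
  \<comment> \<open>For \<open>k = 1\<close> there are no contrasts and the divisor is 1; the
    restriction to \<open>I\<close> changes nothing because points of the space are already
    extensional.\<close>
  have id: "helmert_inv I 1 w = w" if "w \<in> space (gauss_tuple K I)" for w
  proof -
    have "w 1 \<in> extensional I" using that 1 by (auto simp: space_PiM PiE_iff)
    then show ?thesis
      by (auto simp: helmert_inv_def fun_eq_iff restrict_def extensional_def)
  qed
  show ?case
    using id by (simp cong: measurable_cong distr_cong)
next
  case (Suc k)
  let ?G = "gauss_tuple K I"
  let ?R = "rot_slots I (1 / sqrt (real (Suc k))) (- sqrt (real k) / sqrt (real (Suc k))) k (Suc k)"
  have kK: "k \<in> K" "Suc k \<in> K" "{1..k} \<subseteq> K" using Suc by auto
  have IH: "helmert_inv I k \<in> measurable ?G ?G" "distr ?G ?G (helmert_inv I k) = ?G"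
    using Suc.IH kK by auto
  have R: "?R \<in> measurable ?G ?G"
    using kK by (intro measurable_rot_slots I) auto
  have "distr ?G ?G ?R = ?G"
    using kK Suc.hyps by (intro distr_rot_slots I K) (auto simp: power_divide add_divide_distrib[symmetric])
  moreover have eq: "helmert_inv I (Suc k) = helmert_inv I k \<circ> ?R"
    by (rule ext) (simp only: o_apply helmert_inv_Suc[OF Suc.hyps])
  ultimately have "distr ?G ?G (helmert_inv I (Suc k)) = ?G"
    using distr_distr[OF IH(1) R] IH(2) by simp
  moreover have "helmert_inv I (Suc k) \<in> measurable ?G ?G"
    unfolding eq by (rule measurable_comp[OF R IH(1)])
  ultimately show ?case by simp
qed

section \<open>Normal laws as images of the standard one, and second moments\<close>

lemma normal_eq_distr_std_gauss:
  assumes "c \<noteq> 0"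
  shows "density lborel (normal_density m \<bar>c\<bar>) = distr std_gauss borel (\<lambda>x. m + c * x)"
proof -
  interpret prob_space std_gauss by (rule prob_space_std_gauss)
  have "distributed std_gauss lborel (\<lambda>x. x) (normal_density 0 1)"
    unfolding distributed_def by (auto simp: distr_id2)
  from normal_density_affine[OF this, of c m] assms
  have "distributed std_gauss lborel (\<lambda>x. m + c * x) (normal_density m \<bar>c\<bar>)"
    by simp
  from distributed_distr_eq_density[OF this]
  have "distr std_gauss lborel (\<lambda>x. m + c * x) = density lborel (normal_density m \<bar>c\<bar>)" .
  moreover have "distr std_gauss lborel (\<lambda>x. m + c * x) = distr std_gauss borel (\<lambda>x. m + c * x)"
    by (intro distr_cong) auto
  ultimately show ?thesis by simp
qed

text \<open>\<open>c\<close> may be negative: the noise is later subtracted from a centre, with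
  \<open>c = - \<sigma>\<close>.\<close>

lemma PiM_normal_eq_distr:
  assumes "finite I" "c \<noteq> 0"
  shows "PiM I (\<lambda>i. density lborel (normal_density (m i) \<bar>c\<bar>))
    = distr (PiM I (\<lambda>_. std_gauss)) (PiM I (\<lambda>_. borel)) (\<lambda>z. \<lambda>i\<in>I. m i + c * z i)"
  unfolding normal_eq_distr_std_gauss[OF assms(2)]
  using distr_PiM_componentwise[OF assms(1) prob_space_std_gauss, of "\<lambda>i x. m i + c * x" "\<lambda>_. borel"]
  by simp

text \<open>Distinct slots of a larger tuple of independent standard vectors form such a tuple
  again, which is then scaled. The injection \<open>t\<close> says which slots are used: the centres
  keep their own, while \<open>u\<^sub>q\<close> will be taken from slot 0.\<close>

lemma PiM_PiM_normal_eq_distr: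
  assumes I: "finite I" and K: "finite K" and sd: "\<And>k. sd k > 0"
    and t: "inj_on t K" "t \<in> K \<rightarrow> L"
  shows "PiM K (\<lambda>k. PiM I (\<lambda>_. density lborel (normal_density 0 (sd k))))
    = distr (gauss_tuple L I) (PiM K (\<lambda>_. PiM I (\<lambda>_. borel))) (\<lambda>w. \<lambda>k\<in>K. \<lambda>i\<in>I. sd k * w (t k) i)"
proof -
  let ?E = "PiM I (\<lambda>_. std_gauss)" and ?B = "PiM I (\<lambda>_. borel :: real measure)"
  have E: "prob_space ?E" by (intro prob_space_PiM prob_space_std_gauss)
  have sc: "(\<lambda>z. \<lambda>i\<in>I. sd k * z i) \<in> measurable ?E ?B" for k
    by measurable
  have re: "distr (gauss_tuple L I) (gauss_tuple K I) (\<lambda>w. \<lambda>k\<in>K. w (t k)) = gauss_tuple K I"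
    using distr_PiM_reindex[OF E t] by simp
  have re_m: "(\<lambda>w. \<lambda>k\<in>K. w (t k)) \<in> measurable (gauss_tuple L I) (gauss_tuple K I)"
    using t by (intro measurable_restrict measurable_component_singleton) auto
  have "PiM K (\<lambda>k. PiM I (\<lambda>_. density lborel (normal_density 0 (sd k))))
    = PiM K (\<lambda>k. distr ?E ?B (\<lambda>z. \<lambda>i\<in>I. sd k * z i))"
    using PiM_normal_eq_distr[OF I, of "sd k" "\<lambda>_. 0" for k] sd
    by (simp add: less_imp_neq[symmetric] abs_of_pos)
  also have "\<dots> = distr (gauss_tuple K I) (PiM K (\<lambda>_. ?B)) (\<lambda>w. \<lambda>k\<in>K. \<lambda>i\<in>I. sd k * w k i)"
    by (rule distr_PiM_componentwise[OF K E sc, symmetric])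
  also have "\<dots> = distr (gauss_tuple L I) (PiM K (\<lambda>_. ?B)) ((\<lambda>w. \<lambda>k\<in>K. \<lambda>i\<in>I. sd k * w k i) \<circ> (\<lambda>w. \<lambda>k\<in>K. w (t k)))"
    by (subst re[symmetric], rule distr_distr[OF _ re_m])
      (auto intro!: measurable_restrict measurable_compose[OF _ sc] measurable_component_singleton)
  also have "\<dots> = distr (gauss_tuple L I) (PiM K (\<lambda>_. ?B)) (\<lambda>w. \<lambda>k\<in>K. \<lambda>i\<in>I. sd k * w (t k) i)"
    by (intro distr_cong) (auto simp: fun_eq_iff)
  finally show ?thesis .
qed

lemma PiM_std_gauss_square:
  assumes i: "i \<in> I"
  shows "integrable (PiM I (\<lambda>_. std_gauss)) (\<lambda>z. (z i)\<^sup>2)"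
    and "(\<integral>z. (z i)\<^sup>2 \<partial>PiM I (\<lambda>_. std_gauss)) = 1"
proof -
  have d: "distr (PiM I (\<lambda>_. std_gauss)) std_gauss (\<lambda>z. z i) = std_gauss"
    using distr_PiM_component[of I "\<lambda>_. std_gauss" i] i prob_space_std_gauss by simp
  have int: "integrable std_gauss (\<lambda>x. x\<^sup>2)"
    using integrable_std_normal_moment[of 2]
    by (subst integrable_density) (auto simp: normal_density_nonneg)
  have val: "(\<integral>x. x\<^sup>2 \<partial>std_gauss) = 1"
    using integral_std_normal_moment_even[of 1]
    by (subst integral_density) (auto simp: normal_density_nonneg)
  have m: "(\<lambda>z. z i) \<in> measurable (PiM I (\<lambda>_. std_gauss)) std_gauss"
    using i by measurable
  show "integrable (PiM I (\<lambda>_. std_gauss)) (\<lambda>z. (z i)\<^sup>2)"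
    using integrable_distr[OF m, of "\<lambda>x. x\<^sup>2"] int d by simp
  show "(\<integral>z. (z i)\<^sup>2 \<partial>PiM I (\<lambda>_. std_gauss)) = 1"
    using integral_distr[OF m, of "\<lambda>x. x\<^sup>2"] val d by simp
qed

lemma PiM_std_gauss_sqnorm:
  shows "integrable (PiM I (\<lambda>_. std_gauss)) (\<lambda>z. \<Sum>i\<in>I. (z i)\<^sup>2)"
    and "(\<integral>z. (\<Sum>i\<in>I. (z i)\<^sup>2) \<partial>PiM I (\<lambda>_. std_gauss)) = real (card I)"
  by (auto simp: PiM_std_gauss_square)

lemma gauss_tuple_sqnorm:
  assumes k: "k \<in> K"
  shows "integrable (gauss_tuple K I) (\<lambda>w. \<Sum>i\<in>I. (w k i)\<^sup>2)"
    and "(\<integral>w. (\<Sum>i\<in>I. (w k i)\<^sup>2) \<partial>gauss_tuple K I) = real (card I)"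
proof -
  let ?E = "PiM I (\<lambda>_. std_gauss)"
  have d: "distr (gauss_tuple K I) ?E (\<lambda>w. w k) = ?E"
    using distr_PiM_component[of K "\<lambda>_. ?E" k] k prob_space_std_gauss by (simp add: prob_space_PiM)
  have m: "(\<lambda>w. w k) \<in> measurable (gauss_tuple K I) ?E"
    using k by (rule measurable_component_singleton)
  have f: "(\<lambda>z. \<Sum>i\<in>I. (z i)\<^sup>2) \<in> borel_measurable ?E"
    by measurable
  show "integrable (gauss_tuple K I) (\<lambda>w. \<Sum>i\<in>I. (w k i)\<^sup>2)"
    using integrable_distr[OF m, of "\<lambda>z. \<Sum>i\<in>I. (z i)\<^sup>2"] PiM_std_gauss_sqnorm(1)[of I] d by simp
  show "(\<integral>w. (\<Sum>i\<in>I. (w k i)\<^sup>2) \<partial>gauss_tuple K I) = real (card I)"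
    using integral_distr[OF m f] PiM_std_gauss_sqnorm(2)[of I] d by simp
qed

section \<open>The entropy as a Gaussian integral\<close>

declare One_nat_def [simp del]

lemma sets_gauss_tuple: "sets (gauss_tuple K I) = sets (PiM K (\<lambda>_. PiM I (\<lambda>_. borel)))"
  by (intro sets_PiM_cong refl) (auto intro: sets_PiM_cong)

text \<open>Every term is at most 1, which bounds the mean by 1; dropping all terms but the
  \<open>j\<close>-th bounds it from below by \<open>exp (- A j) / q\<close>.\<close>

lemma neg_ln_mean_exp_bounds:
  fixes A :: "nat \<Rightarrow> real"
  assumes A: "\<And>l. l \<in> {1..q} \<Longrightarrow> 0 \<le> A l" and j: "j \<in> {1..q}"
  shows "0 \<le> - ln ((1 / real q) * (\<Sum>l\<in>{1..q}. exp (- A l)))"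
    and "- ln ((1 / real q) * (\<Sum>l\<in>{1..q}. exp (- A l))) \<le> ln (real q) + A j"
proof -
  have q: "real q > 0" using j by auto
  have le: "exp (- A j) \<le> (\<Sum>l\<in>{1..q}. exp (- A l))"
    using j by (intro member_le_sum) auto
  have "(\<Sum>l\<in>{1..q}. exp (- A l)) \<le> (\<Sum>l\<in>{1..q}. 1)"
    using A by (intro sum_mono) auto
  then have "(1 / real q) * (\<Sum>l\<in>{1..q}. exp (- A l)) \<le> 1"
    using q by (simp add: divide_le_eq)
  moreover have "0 < (1 / real q) * (\<Sum>l\<in>{1..q}. exp (- A l))"
    using q less_le_trans[OF exp_gt_zero le] by simp
  ultimately show "0 \<le> - ln ((1 / real q) * (\<Sum>l\<in>{1..q}. exp (- A l)))"
    using ln_le_zero_iff by auto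
  have "ln (exp (- A j) / real q) \<le> ln ((1 / real q) * (\<Sum>l\<in>{1..q}. exp (- A l)))"
    using q le less_le_trans[OF exp_gt_zero le] by (subst ln_le_cancel_iff) (auto intro!: divide_right_mono)
  then show "- ln ((1 / real q) * (\<Sum>l\<in>{1..q}. exp (- A l))) \<le> ln (real q) + A j"
    using q by (simp add: ln_div)
qed

text \<open>Slot 0 holds the noise direction, so that up to an additive constant this is minus the log
  density of the mixture with centres \<open>w 1, \<dots>, w q\<close>, evaluated at \<open>w j\<close> minus noise;
  \<open>c\<close> is the ratio of the two standard deviations.\<close>
definition neg_log_mix :: "nat \<Rightarrow> nat \<Rightarrow> real \<Rightarrow> nat \<Rightarrow> (nat \<Rightarrow> nat \<Rightarrow> real) \<Rightarrow> real" where
  "neg_log_mix n q c j w = - ln ((1 / real q) * (\<Sum>l\<in>{1..q}.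
     exp (- ((\<Sum>i\<in>{1..n}. (w 0 i + c * (w l i - w j i))\<^sup>2) / 2))))"

text \<open>In the term \<open>l = j\<close> the centres cancel and only the noise is left, so the
  upper bound is the same for all centres.\<close>

lemma neg_log_mix_bounds:
  assumes "j \<in> {1..q}"
  shows "0 \<le> neg_log_mix n q c j w"
    and "neg_log_mix n q c j w \<le> ln (real q) + (\<Sum>i\<in>{1..n}. (w 0 i)\<^sup>2) / 2"
  using neg_ln_mean_exp_bounds[of q "\<lambda>l. (\<Sum>i\<in>{1..n}. (w 0 i + c * (w l i - w j i))\<^sup>2) / 2", OF _ assms]
  by (simp_all add: neg_log_mix_def sum_nonneg)

lemma neg_log_mix_cong:
  assumes "\<And>k i. k \<in> insert 0 {1..q} \<Longrightarrow> i \<in> {1..n} \<Longrightarrow> w k i = w' k i" "j \<in> {1..q}"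
  shows "neg_log_mix n q c j w = neg_log_mix n q c j w'"
proof -
  have "(\<Sum>i\<in>{1..n}. (w 0 i + c * (w l i - w j i))\<^sup>2) = (\<Sum>i\<in>{1..n}. (w' 0 i + c * (w' l i - w' j i))\<^sup>2)"
    if "l \<in> {1..q}" for l
    using assms that by (intro sum.cong refl) simp
  then show ?thesis by (simp add: neg_log_mix_def cong: sum.cong_simp)
qed

lemma measurable_neg_log_mix [measurable]:
  assumes "j \<in> {1..q}"
  shows "neg_log_mix n q c j \<in> borel_measurable (gauss_tuple (insert 0 {1..q}) {1..n})"
proof -
  have sq: "(\<lambda>w. (w 0 i + c * (w l i - w j i))\<^sup>2) \<in> borel_measurable (gauss_tuple (insert 0 {1..q}) {1..n})"
    if "l \<in> {1..q}" "i \<in> {1..n}" for l i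
    using that assms
    by (intro borel_measurable_power borel_measurable_add borel_measurable_diff borel_measurable_times
        borel_measurable_const measurable_gauss_tuple_coord) auto
  show ?thesis
    unfolding neg_log_mix_def[abs_def] using sq
    by (intro borel_measurable_uminus borel_measurable_ln borel_measurable_times borel_measurable_const
        borel_measurable_sum borel_measurable_exp borel_measurable_divide measurable_compose[OF _ borel_measurable_exp]) auto
qed

lemma integrable_neg_log_mix:
  assumes "j \<in> {1..q}"
  shows "integrable (gauss_tuple (insert 0 {1..q}) {1..n}) (neg_log_mix n q c j)"
proof (rule Bochner_Integration.integrable_bound)
  interpret prob_space "gauss_tuple (insert 0 {1..q}) {1..n}"
    by (intro prob_space_PiM prob_space_std_gauss)
  show "integrable (gauss_tuple (insert 0 {1..q}) {1..n}) (\<lambda>w. ln (real q) + (\<Sum>i\<in>{1..n}. (w 0 i)\<^sup>2) / 2)"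
    using gauss_tuple_sqnorm(1)[of 0 "insert 0 {1..q}" "{1..n}"] by simp
  show "AE w in gauss_tuple (insert 0 {1..q}) {1..n}. norm (neg_log_mix n q c j w)
      \<le> norm (ln (real q) + (\<Sum>i\<in>{1..n}. (w 0 i)\<^sup>2) / 2)"
    using neg_log_mix_bounds[OF assms, of n c] by (intro AE_I2) (smt (verit) real_norm_def)
qed (use assms in measurable)

section \<open>Entropy for fixed centres\<close>

lemma normal_density_prod:
  assumes "\<sigma> > 0"
  shows "(\<Prod>i\<in>{1..n}. normal_density (m i) \<sigma> (x i))
    = (2 * pi * \<sigma>\<^sup>2) powr (- real n / 2) * exp (- sqnorm n (\<lambda>i. x i - m i) / (2 * \<sigma>\<^sup>2))"
proof -
  have "(\<Prod>i\<in>{1..n}. normal_density (m i) \<sigma> (x i))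
    = (1 / sqrt (2 * pi * \<sigma>\<^sup>2)) ^ n * exp (\<Sum>i\<in>{1..n}. - (x i - m i)\<^sup>2 / (2 * \<sigma>\<^sup>2))"
    by (simp add: normal_density_def prod.distrib exp_sum power_divide prod_dividef)
  also have "(\<Sum>i\<in>{1..n}. - (x i - m i)\<^sup>2 / (2 * \<sigma>\<^sup>2)) = - sqnorm n (\<lambda>i. x i - m i) / (2 * \<sigma>\<^sup>2)"
    by (simp add: sqnorm_def dotv_def power2_eq_square sum_divide_distrib sum_negf)
  also have "(1 / sqrt (2 * pi * \<sigma>\<^sup>2)) ^ n = (2 * pi * \<sigma>\<^sup>2) powr (- real n / 2)"
  proof -
    have "(1 / sqrt X) ^ n = X powr (- real n / 2)" if "X > 0" for X
    proof -
      have "1 / sqrt X = X powr (- (1 / 2))"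
        using that by (simp only: powr_minus_divide powr_half_sqrt less_imp_le)
      moreover have "(X powr (- (1 / 2))) ^ n = (X powr (- (1 / 2))) powr real n"
        using that by (intro powr_realpow[symmetric]) simp
      ultimately show ?thesis by (simp add: powr_powr)
    qed
    then show ?thesis using assms by simp
  qed
  finally show ?thesis .
qed

text \<open>The noise is subtracted so that, for \<open>m = w j\<close>, the vector
  \<open>x - w l\<close> is \<open>- \<sigma>\<close> times
  \<open>z + (w l - w j) / \<sigma>\<close>, the vector in the exponents of
  \<open>neg_log_mix\<close>.\<close>

lemma normal_density_lebR_eq_distr:
  assumes "\<sigma> > 0"
  shows "density (lebR n) (\<lambda>x. ennreal (\<Prod>i\<in>{1..n}. normal_density (m i) \<sigma> (x i)))
    = distr (PiM {1..n} (\<lambda>_. std_gauss)) (PiM {1..n} (\<lambda>_. borel)) (\<lambda>z. \<lambda>i\<in>{1..n}. m i - \<sigma> * z i)"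
proof -
  have "density (lebR n) (\<lambda>x. ennreal (\<Prod>i\<in>{1..n}. normal_density (m i) \<sigma> (x i)))
    = density (lebR n) (\<lambda>x. \<Prod>i\<in>{1..n}. ennreal (normal_density (m i) \<sigma> (x i)))"
    by (simp add: prod_ennreal normal_density_nonneg)
  also have "\<dots> = PiM {1..n} (\<lambda>i. density lborel (normal_density (m i) \<sigma>))"
    unfolding lebR_def
    by (rule PiM_density_lborel[symmetric]) (use assms in \<open>auto intro: prob_space_normal_density\<close>)
  also have "\<dots> = distr (PiM {1..n} (\<lambda>_. std_gauss)) (PiM {1..n} (\<lambda>_. borel)) (\<lambda>z. \<lambda>i\<in>{1..n}. m i - \<sigma> * z i)"
    using PiM_normal_eq_distr[of "{1..n}" "- \<sigma>" m] assms by simp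
  finally show ?thesis .
qed

text \<open>Write the density as \<open>C * exp (- L x)\<close>. It is the mean of the component
  densities \<open>\<phi> j\<close>, so the entropy is \<open>- ln C\<close> plus the mean over
  \<open>j\<close> of the expectation of \<open>L\<close> under component \<open>j\<close>, where
  the point is \<open>w j - \<sigma> z\<close>.\<close>

lemma diff_entropy_mix_density:
  assumes \<sigma>: "\<sigma> > 0" and q: "q \<ge> 1"
  shows "diff_entropy n (mix_density n q \<sigma> w) = real n / 2 * ln (2 * pi * \<sigma>\<^sup>2)
    + (1 / real q) * (\<Sum>j\<in>{1..q}. \<integral>z. neg_log_mix n q (1 / \<sigma>) j (w(0 := z)) \<partial>PiM {1..n} (\<lambda>_. std_gauss))"
proof -
  let ?E = "PiM {1..n} (\<lambda>_. std_gauss) :: (nat \<Rightarrow> real) measure"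
  let ?B = "PiM {1..n} (\<lambda>_. borel) :: (nat \<Rightarrow> real) measure"
  interpret E: prob_space ?E by (intro prob_space_PiM prob_space_std_gauss)
  have sB: "sets (lebR n) = sets ?B" "sets ?E = sets ?B"
    unfolding lebR_def by (auto intro!: sets_PiM_cong)
  have mB: "borel_measurable (lebR n) = borel_measurable ?B" "borel_measurable ?E = borel_measurable ?B"
    using sB by (auto intro!: measurable_cong_sets)
  define C where "C = (2 * pi * \<sigma>\<^sup>2) powr (- real n / 2)"
  define L where "L x = - ln ((1 / real q) * (\<Sum>l\<in>{1..q}. exp (- sqnorm n (\<lambda>i. x i - w l i) / (2 * \<sigma>\<^sup>2))))" for x
  define \<phi> where "\<phi> j x = (\<Prod>i\<in>{1..n}. normal_density (w j i) \<sigma> (x i))" for j x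
  have C: "C > 0" using \<sigma> by (simp add: C_def)
  have lnC: "ln C = - (real n / 2 * ln (2 * pi * \<sigma>\<^sup>2))"
    using \<sigma> by (simp add: C_def ln_powr)
  have [measurable]: "\<phi> j \<in> borel_measurable ?B" for j
    unfolding \<phi>_def[abs_def] by measurable
  have [measurable]: "L \<in> borel_measurable ?B"
    unfolding L_def[abs_def] sqnorm_def dotv_def by measurable
  have split: "mix_density n q \<sigma> w x * ln (mix_density n q \<sigma> w x)
      = (\<Sum>j\<in>{1..q}. (1 / real q) * (\<phi> j x * (ln C - L x)))" for x
  proof -
    have pos: "(1 / real q) * (\<Sum>l\<in>{1..q}. exp (- sqnorm n (\<lambda>i. x i - w l i) / (2 * \<sigma>\<^sup>2))) > 0"
      using q by (intro mult_pos_pos sum_pos) auto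
    have "mix_density n q \<sigma> w x
      = C * ((1 / real q) * (\<Sum>l\<in>{1..q}. exp (- sqnorm n (\<lambda>i. x i - w l i) / (2 * \<sigma>\<^sup>2))))"
      by (simp add: mix_density_def C_def)
    then have "ln (mix_density n q \<sigma> w x) = ln C - L x"
      using ln_mult_pos[OF C pos] by (simp add: L_def)
    moreover have "mix_density n q \<sigma> w x = (\<Sum>j\<in>{1..q}. (1 / real q) * \<phi> j x)"
      unfolding mix_density_def \<phi>_def normal_density_prod[OF \<sigma>] by (simp add: sum_distrib_left mult_ac)
    ultimately show ?thesis by (simp add: sum_distrib_right mult.assoc)
  qed
  have L_shift: "L (\<lambda>i\<in>{1..n}. w j i - \<sigma> * z i) = neg_log_mix n q (1 / \<sigma>) j (w(0 := z))"
    if j: "j \<in> {1..q}" for j z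
  proof -
    have "- sqnorm n (\<lambda>i. (\<lambda>i\<in>{1..n}. w j i - \<sigma> * z i) i - w l i) / (2 * \<sigma>\<^sup>2)
        = - ((\<Sum>i\<in>{1..n}. ((w(0 := z)) 0 i + (1 / \<sigma>) * ((w(0 := z)) l i - (w(0 := z)) j i))\<^sup>2) / 2)"
      if l: "l \<in> {1..q}" for l
    proof -
      have "sqnorm n (\<lambda>i. (\<lambda>i\<in>{1..n}. w j i - \<sigma> * z i) i - w l i)
        = (\<Sum>i\<in>{1..n}. (w j i - \<sigma> * z i - w l i)\<^sup>2)"
        by (simp add: sqnorm_def dotv_def power2_eq_square)
      also have "\<dots> = (\<Sum>i\<in>{1..n}. \<sigma>\<^sup>2 * (z i + (1 / \<sigma>) * (w l i - w j i))\<^sup>2)"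
        using \<sigma> by (intro sum.cong refl) (simp add: field_simps power2_eq_square)
      finally show ?thesis
        using \<sigma> j l by (simp add: sum_distrib_left[symmetric])
    qed
    then show ?thesis unfolding L_def neg_log_mix_def
      by (intro arg_cong[of _ _ "\<lambda>S. - ln (1 / real q * S)"] sum.cong refl arg_cong[of _ _ exp])
  qed
  have int: "integrable ?E (\<lambda>z. neg_log_mix n q (1 / \<sigma>) j (w(0 := z)))" if j: "j \<in> {1..q}" for j
  proof (rule Bochner_Integration.integrable_bound)
    show "integrable ?E (\<lambda>z. ln (real q) + (\<Sum>i\<in>{1..n}. (z i)\<^sup>2) / 2)"
      using PiM_std_gauss_sqnorm(1)[of "{1..n}"] by simp
    \<comment> \<open>Here \<open>w\<close> is an arbitrary function, not a point of the product
      space, so measurability in \<open>z\<close> is obtained from that of \<open>L\<close>.\<close>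
    have "(\<lambda>z. L (\<lambda>i\<in>{1..n}. w j i - \<sigma> * z i)) \<in> borel_measurable ?E"
      by measurable
    then show "(\<lambda>z. neg_log_mix n q (1 / \<sigma>) j (w(0 := z))) \<in> borel_measurable ?E"
      unfolding L_shift[OF j] .
    show "AE z in ?E. norm (neg_log_mix n q (1 / \<sigma>) j (w(0 := z))) \<le> norm (ln (real q) + (\<Sum>i\<in>{1..n}. (z i)\<^sup>2) / 2)"
    proof (rule AE_I2)
      fix z
      show "norm (neg_log_mix n q (1 / \<sigma>) j (w(0 := z))) \<le> norm (ln (real q) + (\<Sum>i\<in>{1..n}. (z i)\<^sup>2) / 2)"
        using neg_log_mix_bounds[OF j, of n "1 / \<sigma>" "w(0 := z)"] by simp
    qed
  qed
  have shift: "integrable (lebR n) (\<lambda>x. \<phi> j x * (ln C - L x))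
      \<and> (\<integral>x. \<phi> j x * (ln C - L x) \<partial>lebR n) = ln C - (\<integral>z. neg_log_mix n q (1 / \<sigma>) j (w(0 := z)) \<partial>?E)"
    if j: "j \<in> {1..q}" for j
  proof -
    let ?T = "\<lambda>z. \<lambda>i\<in>{1..n}. w j i - \<sigma> * z i"
    have T: "?T \<in> measurable ?E ?B" by measurable
    have h: "(\<lambda>x. ln C - L x) \<in> borel_measurable ?B" by measurable
    have d: "density (lebR n) (\<lambda>x. ennreal (\<phi> j x)) = distr ?E ?B ?T"
      unfolding \<phi>_def by (rule normal_density_lebR_eq_distr[OF \<sigma>])
    have nn: "AE x in lebR n. 0 \<le> \<phi> j x"
      by (intro AE_I2) (auto simp: \<phi>_def normal_density_nonneg prod_nonneg)
    have "integrable (lebR n) (\<lambda>x. \<phi> j x *\<^sub>R (ln C - L x)) \<longleftrightarrow> integrable (distr ?E ?B ?T) (\<lambda>x. ln C - L x)"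
      unfolding d[symmetric] by (rule integrable_density[symmetric]) (use nn in \<open>auto simp: mB\<close>)
    also have "\<dots> \<longleftrightarrow> integrable ?E (\<lambda>z. ln C - neg_log_mix n q (1 / \<sigma>) j (w(0 := z)))"
      by (simp add: integrable_distr_eq[OF T h] L_shift[OF j])
    finally have 1: "integrable (lebR n) (\<lambda>x. \<phi> j x * (ln C - L x))"
      using int[OF j] by simp
    have "(\<integral>x. \<phi> j x *\<^sub>R (ln C - L x) \<partial>lebR n) = (\<integral>x. ln C - L x \<partial>distr ?E ?B ?T)"
      unfolding d[symmetric] by (rule integral_density[symmetric]) (use nn in \<open>auto simp: mB\<close>)
    also have "\<dots> = (\<integral>z. ln C - neg_log_mix n q (1 / \<sigma>) j (w(0 := z)) \<partial>?E)"
      by (simp add: integral_distr[OF T h] L_shift[OF j])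
    also have "\<dots> = ln C - (\<integral>z. neg_log_mix n q (1 / \<sigma>) j (w(0 := z)) \<partial>?E)"
      using int[OF j] by (simp add: E.prob_space)
    finally show ?thesis using 1 by simp
  qed
  have "diff_entropy n (mix_density n q \<sigma> w)
      = - (\<Sum>j\<in>{1..q}. (1 / real q) * (ln C - (\<integral>z. neg_log_mix n q (1 / \<sigma>) j (w(0 := z)) \<partial>?E)))"
    unfolding diff_entropy_def split using shift
    by (subst Bochner_Integration.integral_sum) (auto intro!: sum.cong)
  also have "\<dots> = - ln C + (1 / real q) * (\<Sum>j\<in>{1..q}. \<integral>z. neg_log_mix n q (1 / \<sigma>) j (w(0 := z)) \<partial>?E)"
    using q by (simp add: sum_subtractf sum_divide_distrib[symmetric] diff_divide_distrib)
  finally show ?thesis by (simp add: lnC)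
qed

section \<open>Averaging over the centres\<close>

lemma neg_log_mix_transpose:
  assumes j: "j \<in> {1..q}"
  defines "t \<equiv> Transposition.transpose j q"
  shows "neg_log_mix n q c j (\<lambda>k. if k = 0 then w 0 else w (t k)) = neg_log_mix n q c q w"
proof -
  have t: "t l \<in> {1..q}" "t (t l) = l" if "l \<in> {1..q}" for l
    using that j unfolding t_def by (auto simp: Transposition.transpose_def)
  have tj: "t j = q" by (simp add: t_def)
  \<comment> \<open>The transposition permutes the summands, and it sends the reference centre
    \<open>j\<close> to \<open>q\<close>.\<close>
  have "(\<Sum>l\<in>{1..q}. exp (- ((\<Sum>i\<in>{1..n}. (w 0 i + c * (w (t l) i - w q i))\<^sup>2) / 2)))
     = (\<Sum>l\<in>{1..q}. exp (- ((\<Sum>i\<in>{1..n}. (w 0 i + c * (w l i - w q i))\<^sup>2) / 2)))"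
    by (rule sum.reindex_bij_witness[of _ t t]) (use t in auto)
  then show ?thesis using j unfolding neg_log_mix_def by (simp add: tj cong: sum.cong_simp)
qed

text \<open>Fubini for the noise slot. Since the bounds on \<open>neg_log_mix\<close> are free of
  the centres, the mean over the noise lies between 0 and \<open>ln q + n / 2\<close> for every
  \<open>w\<close>, hence is integrable.\<close>

lemma integral_neg_log_mix_insert:
  assumes j: "j \<in> {1..q}"
  shows "integrable (gauss_tuple {1..q} {1..n}) (\<lambda>w. \<integral>z. neg_log_mix n q c j (w(0 := z)) \<partial>PiM {1..n} (\<lambda>_. std_gauss))"
    and "(\<integral>w. (\<integral>z. neg_log_mix n q c j (w(0 := z)) \<partial>PiM {1..n} (\<lambda>_. std_gauss)) \<partial>gauss_tuple {1..q} {1..n})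
      = (\<integral>w. neg_log_mix n q c j w \<partial>gauss_tuple (insert 0 {1..q}) {1..n})"
proof -
  let ?E = "PiM {1..n} (\<lambda>_. std_gauss) :: (nat \<Rightarrow> real) measure"
  let ?G = "gauss_tuple {1..q} {1..n}"
  interpret E: prob_space ?E by (intro prob_space_PiM prob_space_std_gauss)
  interpret G: prob_space ?G by (intro prob_space_PiM prob_space_std_gauss)
  interpret P: product_prob_space "\<lambda>_. ?E" "{1..q}"
    by (intro product_prob_spaceI E.prob_space_axioms)
  interpret GE: pair_sigma_finite ?G ?E ..
  note [measurable] = measurable_neg_log_mix[OF j]
  have bound: "norm (\<integral>z. neg_log_mix n q c j (w(0 := z)) \<partial>?E) \<le> ln (real q) + real n / 2" for w
  proof -
    have "norm (\<integral>z. neg_log_mix n q c j (w(0 := z)) \<partial>?E) = (\<integral>z. neg_log_mix n q c j (w(0 := z)) \<partial>?E)"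
      using neg_log_mix_bounds(1)[OF j] by (simp add: integral_nonneg_AE)
    \<comment> \<open>This monotonicity holds for every \<open>w\<close>: were the left integrand
      not integrable, its integral would be 0 by convention, which the nonnegative right-hand side
      allows.\<close>
    also have "\<dots> \<le> (\<integral>z. ln (real q) + (\<Sum>i\<in>{1..n}. (z i)\<^sup>2) / 2 \<partial>?E)"
    proof (rule integral_mono')
      show "integrable ?E (\<lambda>z. ln (real q) + (\<Sum>i\<in>{1..n}. (z i)\<^sup>2) / 2)"
        using PiM_std_gauss_sqnorm(1)[of "{1..n}"] by simp
    next
      fix z
      show "neg_log_mix n q c j (w(0 := z)) \<le> ln (real q) + (\<Sum>i\<in>{1..n}. (z i)\<^sup>2) / 2"
        using neg_log_mix_bounds(2)[OF j, of n c "w(0 := z)"] by simp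
    next
      fix z :: "nat \<Rightarrow> real"
      show "0 \<le> ln (real q) + (\<Sum>i\<in>{1..n}. (z i)\<^sup>2) / 2"
        using j by (auto intro!: add_nonneg_nonneg sum_nonneg)
    qed
    also have "\<dots> = ln (real q) + real n / 2"
      using PiM_std_gauss_sqnorm[of "{1..n}"] by (simp add: E.prob_space)
    finally show ?thesis .
  qed
  show "integrable ?G (\<lambda>w. \<integral>z. neg_log_mix n q c j (w(0 := z)) \<partial>?E)"
    by (rule G.integrable_const_bound[of _ "ln (real q) + real n / 2"]) (use bound in auto)
  show "(\<integral>w. (\<integral>z. neg_log_mix n q c j (w(0 := z)) \<partial>?E) \<partial>?G)
      = (\<integral>w. neg_log_mix n q c j w \<partial>gauss_tuple (insert 0 {1..q}) {1..n})"
    by (rule P.product_integral_insert[symmetric]) (use integrable_neg_log_mix[OF j] in auto)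
qed

text \<open>The centres are exchangeable: transposing slots \<open>j\<close> and \<open>q\<close>
  fixes slot 0 and preserves the law of the tuple.\<close>

lemma integral_neg_log_mix_exchange:
  assumes j: "j \<in> {1..q}"
  shows "(\<integral>w. neg_log_mix n q c j w \<partial>gauss_tuple (insert 0 {1..q}) {1..n})
      = (\<integral>w. neg_log_mix n q c q w \<partial>gauss_tuple (insert 0 {1..q}) {1..n})"
proof -
  let ?E = "PiM {1..n} (\<lambda>_. std_gauss) :: (nat \<Rightarrow> real) measure"
  let ?K = "insert 0 {1..q}"
  let ?G = "gauss_tuple ?K {1..n}"
  have E: "prob_space ?E" by (intro prob_space_PiM prob_space_std_gauss)
  define t where "t = Transposition.transpose j q"
  have t: "inj_on t ?K" "t \<in> ?K \<rightarrow> ?K" and t0: "t 0 = 0"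
    using j unfolding t_def by (auto simp: Transposition.transpose_def inj_on_def)
  have d: "distr ?G ?G (\<lambda>w. \<lambda>k\<in>?K. w (t k)) = ?G"
    using distr_PiM_reindex[OF E t] by simp
  have m: "(\<lambda>w. \<lambda>k\<in>?K. w (t k)) \<in> measurable ?G ?G"
    by (intro measurable_restrict measurable_component_singleton funcset_mem[OF t(2)])
  have "neg_log_mix n q c j (\<lambda>k\<in>?K. w (t k)) = neg_log_mix n q c q w" for w
    unfolding neg_log_mix_transpose[OF j, of n c w, symmetric] t_def[symmetric]
    by (rule neg_log_mix_cong[OF _ j]) (auto simp: t0)
  then show ?thesis
    using integral_distr[OF m measurable_neg_log_mix[OF j]] unfolding d by simp
qed

text \<open>The centres are \<open>s\<close> times standard vectors, so only the ratio
  \<open>s / \<sigma>\<close> remains; by exchangeability the \<open>q\<close> components contribute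
  equally and their mean is the contribution of component \<open>q\<close>.\<close>

lemma cond_entropy_eq:
  assumes \<sigma>: "\<sigma> > 0" and s: "s > 0" and q: "q \<ge> 1"
  shows "cond_entropy n q \<sigma> s = real n / 2 * ln (2 * pi * \<sigma>\<^sup>2)
    + (\<integral>w. neg_log_mix n q (s / \<sigma>) q w \<partial>gauss_tuple (insert 0 {1..q}) {1..n})"
proof -
  let ?E = "PiM {1..n} (\<lambda>_. std_gauss) :: (nat \<Rightarrow> real) measure"
  let ?G = "gauss_tuple {1..q} {1..n}"
  let ?B = "PiM {1..q} (\<lambda>_. PiM {1..n} (\<lambda>_. borel :: real measure))"
  let ?S = "\<lambda>w. \<lambda>k\<in>{1..q}. \<lambda>i\<in>{1..n}. s * w k i"
  define J where "J c j w = (\<integral>z. neg_log_mix n q c j (w(0 := z)) \<partial>?E)" for c j w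
  interpret E: prob_space ?E by (intro prob_space_PiM prob_space_std_gauss)
  interpret G: prob_space ?G by (intro prob_space_PiM prob_space_std_gauss)
  interpret GE: pair_sigma_finite ?G ?E ..
  have W: "W_measure n q s = distr ?G ?B ?S"
    unfolding W_measure_def
    using PiM_PiM_normal_eq_distr[of "{1..n}" "{1..q}" "\<lambda>_. s" "\<lambda>k. k" "{1..q}"] s by simp
  have "(\<lambda>w. s * w k i) \<in> borel_measurable ?G" if "k \<in> {1..q}" "i \<in> {1..n}" for k i
    using that by (intro borel_measurable_times borel_measurable_const measurable_gauss_tuple_coord)
  then have "?S \<in> measurable ?G ?G"
    by (intro measurable_restrict) simp
  then have S: "?S \<in> measurable ?G ?B"
    using measurable_cong_sets[OF refl sets_gauss_tuple] by blast
  have "J c j \<in> borel_measurable ?G" if j: "j \<in> {1..q}" for c j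
  proof -
    note [measurable] = measurable_neg_log_mix[OF j]
    show ?thesis unfolding J_def[abs_def] by measurable
  qed
  then have J_B: "J c j \<in> borel_measurable ?B" if "j \<in> {1..q}" for c j
    using that measurable_cong_sets[OF sets_gauss_tuple refl] by blast
  have J_scale: "J (1 / \<sigma>) j (?S w) = J (s / \<sigma>) j w" if j: "j \<in> {1..q}" for j w
  proof -
    have "neg_log_mix n q (1 / \<sigma>) j ((?S w)(0 := z)) = neg_log_mix n q (s / \<sigma>) j (w(0 := z))" for z
      using j by (simp add: neg_log_mix_def right_diff_distrib[symmetric] mult.assoc cong: sum.cong_simp)
    then show ?thesis by (simp add: J_def)
  qed
  have "cond_entropy n q \<sigma> s
    = (\<integral>w. real n / 2 * ln (2 * pi * \<sigma>\<^sup>2) + (1 / real q) * (\<Sum>j\<in>{1..q}. J (1 / \<sigma>) j w) \<partial>distr ?G ?B ?S)"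
    unfolding cond_entropy_def W diff_entropy_mix_density[OF \<sigma> q] J_def ..
  also have "\<dots> = (\<integral>w. real n / 2 * ln (2 * pi * \<sigma>\<^sup>2) + (1 / real q) * (\<Sum>j\<in>{1..q}. J (1 / \<sigma>) j (?S w)) \<partial>?G)"
    using J_B by (intro integral_distr S) measurable
  also have "\<dots> = (\<integral>w. real n / 2 * ln (2 * pi * \<sigma>\<^sup>2) + (1 / real q) * (\<Sum>j\<in>{1..q}. J (s / \<sigma>) j w) \<partial>?G)"
    by (simp add: J_scale cong: sum.cong_simp)
  also have "\<dots> = real n / 2 * ln (2 * pi * \<sigma>\<^sup>2) + (1 / real q) * (\<Sum>j\<in>{1..q}. \<integral>w. J (s / \<sigma>) j w \<partial>?G)"
  proof -
    have J_int: "integrable ?G (J (s / \<sigma>) j)" if "j \<in> {1..q}" for j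
      using integral_neg_log_mix_insert(1)[OF that] unfolding J_def[abs_def] .
    then have "integrable ?G (\<lambda>w. \<Sum>j\<in>{1..q}. J (s / \<sigma>) j w)"
      by (intro Bochner_Integration.integrable_sum)
    moreover have "(\<integral>w. (\<Sum>j\<in>{1..q}. J (s / \<sigma>) j w) \<partial>?G) = (\<Sum>j\<in>{1..q}. \<integral>w. J (s / \<sigma>) j w \<partial>?G)"
      using J_int by (intro Bochner_Integration.integral_sum)
    ultimately show ?thesis by (simp add: G.prob_space)
  qed
  also have "(\<Sum>j\<in>{1..q}. \<integral>w. J (s / \<sigma>) j w \<partial>?G)
    = (\<Sum>j\<in>{1..q}. \<integral>w. neg_log_mix n q (s / \<sigma>) q w \<partial>gauss_tuple (insert 0 {1..q}) {1..n})"
    unfolding J_def by (intro sum.cong refl)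
      (simp only: integral_neg_log_mix_insert(2) integral_neg_log_mix_exchange)
  finally show ?thesis using q by simp
qed

section \<open>The eigenvalues and eigenvectors\<close>

text \<open>\<open>m\<^sub>1\<close> and \<open>m\<^sub>2\<close> are the roots of
  \<open>m\<^sup>2 - (\<mu> + 1) * m + \<mu> / q\<close>, with discriminant
  \<open>D\<close>.\<close>

lemma mj_Vieta:
  assumes q: "q \<ge> 2" and \<mu>: "\<mu> > 0"
  shows "mj q \<mu> 1 + mj q \<mu> 2 = \<mu> + 1" and "mj q \<mu> 1 * mj q \<mu> 2 = \<mu> / real q"
    and "mj q \<mu> 1 > 1" and "mj q \<mu> 2 > 0"
proof -
  define Q where "Q = real q"
  have Q: "Q \<ge> 2" using q by (simp add: Q_def)
  define D where "D = \<mu>\<^sup>2 - (4 / Q - 2) * \<mu> + 1"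
  \<comment> \<open>The first form gives \<open>sqrt D > 1 - \<mu>\<close>, hence the bound on
    \<open>mj q \<mu> 1\<close>; the second gives \<open>sqrt D < \<mu> + 1\<close> and the product
    of the roots.\<close>
  have D1: "D = (1 - \<mu>)\<^sup>2 + 4 * \<mu> * (1 - 1 / Q)"
    using Q by (simp add: D_def power2_eq_square field_simps)
  have D2: "D = (\<mu> + 1)\<^sup>2 - 4 * \<mu> / Q"
    using Q by (simp add: D_def power2_eq_square field_simps)
  have "4 * \<mu> * (1 - 1 / Q) > 0" using Q \<mu> by (intro mult_pos_pos) auto
  then have "D > (1 - \<mu>)\<^sup>2" using D1 by simp
  then have r1: "sqrt D > 1 - \<mu>" by (rule real_less_rsqrt)
  have "D < (\<mu> + 1)\<^sup>2" using D2 Q \<mu> by simp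
  then have r2: "sqrt D < \<mu> + 1" using \<mu> by (intro real_less_lsqrt) auto
  have "D \<ge> 0" using \<open>D > (1 - \<mu>)\<^sup>2\<close> by (smt (verit) zero_le_power2)
  then have r3: "sqrt D * sqrt D = D" by simp
  have m1: "mj q \<mu> 1 = (\<mu> + 1 + sqrt D) / 2" and m2: "mj q \<mu> 2 = (\<mu> + 1 - sqrt D) / 2"
    by (simp_all add: mj_def lam_def D_def Q_def field_simps)
  show "mj q \<mu> 1 + mj q \<mu> 2 = \<mu> + 1" by (simp add: m1 m2 field_simps)
  have "mj q \<mu> 1 * mj q \<mu> 2 = ((\<mu> + 1)\<^sup>2 - sqrt D * sqrt D) / 4"
    unfolding m1 m2 by (simp add: power2_eq_square field_simps del: real_sqrt_mult_self)
  also have "\<dots> = \<mu> / real q" by (simp only: r3) (simp add: D2 Q_def)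
  finally show "mj q \<mu> 1 * mj q \<mu> 2 = \<mu> / real q" .
  show "mj q \<mu> 1 > 1" using r1 by (simp add: m1)
  show "mj q \<mu> 2 > 0" using r2 by (simp add: m2)
qed

text \<open>Vieta's formulas give \<open>x\<^sub>1 * x\<^sub>2 = 1 - q\<close>, the orthogonality of
  the vectors \<open>(\<surd>(q - 1), x\<^sub>j)\<close>. Replacing \<open>q - 1\<close> in
  \<open>N\<^sub>j\<close> accordingly factorises it, and the signs of the factors show that it is
  positive.\<close>

lemma xj_Nj:
  assumes q: "q \<ge> 2" and \<mu>: "\<mu> > 0"
  shows "xj q \<mu> 1 < 0" and "xj q \<mu> 2 > 0" and "xj q \<mu> 1 * xj q \<mu> 2 = 1 - real q"
    and "Nj q \<mu> 1 = xj q \<mu> 1 * (xj q \<mu> 1 - xj q \<mu> 2)"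
    and "Nj q \<mu> 2 = xj q \<mu> 2 * (xj q \<mu> 2 - xj q \<mu> 1)"
    and "Nj q \<mu> 1 > 0" and "Nj q \<mu> 2 > 0"
proof -
  note m = mj_Vieta[OF q \<mu>]
  have "1 * 1 < real q * mj q \<mu> 1" using q m(3) by (intro mult_strict_mono) auto
  then show x1: "xj q \<mu> 1 < 0" by (simp add: xj_def)
  have "xj q \<mu> 1 * xj q \<mu> 2
    = 1 - real q * (mj q \<mu> 1 + mj q \<mu> 2) + (real q)\<^sup>2 * (mj q \<mu> 1 * mj q \<mu> 2)"
    by (simp add: xj_def power2_eq_square algebra_simps)
  also have "\<dots> = 1 - real q"
    using q unfolding m(1,2) by (simp add: power2_eq_square field_simps)
  finally show x12: "xj q \<mu> 1 * xj q \<mu> 2 = 1 - real q" .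
  then have "xj q \<mu> 1 * xj q \<mu> 2 < 0" using q by simp
  then show x2: "xj q \<mu> 2 > 0" using x1 by (simp add: mult_less_0_iff)
  show N1: "Nj q \<mu> 1 = xj q \<mu> 1 * (xj q \<mu> 1 - xj q \<mu> 2)"
    using x12 by (simp add: Nj_def power2_eq_square algebra_simps)
  show N2: "Nj q \<mu> 2 = xj q \<mu> 2 * (xj q \<mu> 2 - xj q \<mu> 1)"
    using x12 by (simp add: Nj_def power2_eq_square algebra_simps)
  show "Nj q \<mu> 1 > 0" unfolding N1 using x1 x2 by (intro mult_neg_neg) auto
  show "Nj q \<mu> 2 > 0" unfolding N2 using x1 x2 by (intro mult_pos_pos) auto
qed

text \<open>The vectors \<open>(\<surd>(q - 1), x\<^sub>j) / \<surd>N\<^sub>j\<close> are the orthonormal eigenvectors, with eigenvalues \<open>m\<^sub>j\<close>, of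
  the precision matrix of \<open>(\<surd>(q - 1) c, D)\<close>; the last two equations read off \<open>c - D = \<kappa> h\<close>.\<close>
lemma eigenvector_rotation:
  assumes q: "q \<ge> 2" and \<mu>: "\<mu> > 0"
  defines "a \<equiv> sqrt \<mu> * xj q \<mu> 2 / sqrt (Nj q \<mu> 2 * mj q \<mu> 2)"
    and "b \<equiv> sqrt \<mu> * xj q \<mu> 1 / sqrt (Nj q \<mu> 1 * mj q \<mu> 1)"
    and "\<kappa> \<equiv> sqrt (real q / (real q - 1))"
  shows "a\<^sup>2 + b\<^sup>2 = 1" and "b < 0"
    and "\<kappa> * a = (1 - xj q \<mu> 1) / sqrt (Nj q \<mu> 1 * mj q \<mu> 1)"
    and "- \<kappa> * b = (1 - xj q \<mu> 2) / sqrt (Nj q \<mu> 2 * mj q \<mu> 2)"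
proof -
  define Q x1 x2 m1 m2 N1 N2 where defs: "Q = real q" "x1 = xj q \<mu> 1" "x2 = xj q \<mu> 2"
    "m1 = mj q \<mu> 1" "m2 = mj q \<mu> 2" "N1 = Nj q \<mu> 1" "N2 = Nj q \<mu> 2"
  have Q: "Q > 1" using q by (simp add: defs)
  have x: "x1 < 0" "x2 > 0" and Nx: "N1 = x1 * (x1 - x2)" "N2 = x2 * (x2 - x1)"
    and N: "N1 > 0" "N2 > 0" and QX: "Q - 1 = - x1 * x2"
    using xj_Nj[OF q \<mu>] by (simp_all add: defs)
  have m: "m1 > 0" "m2 > 0" and mm: "\<mu> = Q * m1 * m2"
    using mj_Vieta[OF q \<mu>] q by (auto simp: defs field_simps)
  have xm: "1 - x1 = Q * m1" "1 - x2 = Q * m2" by (simp_all add: defs xj_def)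
  have d: "x2 - x1 > 0" using x by simp
  \<comment> \<open>\<open>\<mu> = Q * m1 * m2\<close> cancels \<open>m2\<close> and leaves
    \<open>Q * m1 = 1 - x1\<close>, likewise for \<open>b\<close>; the sum of the squares becomes a
    fraction in \<open>x1\<close> and \<open>x2\<close> only.\<close>
  have a2: "a\<^sup>2 = Q * m1 * x2 / (x2 - x1)"
    using x N m \<mu> d unfolding a_def defs(2-)[symmetric]
    by (simp add: power_divide power_mult_distrib) (simp add: Nx mm power2_eq_square)
  have b2: "b\<^sup>2 = - Q * m2 * x1 / (x2 - x1)"
    using x N m \<mu> d unfolding b_def defs(2-)[symmetric]
    by (simp add: power_divide power_mult_distrib) (simp add: Nx mm power2_eq_square field_simps)
  have "a\<^sup>2 + b\<^sup>2 = ((1 - x1) * x2 - (1 - x2) * x1) / (x2 - x1)"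
    unfolding a2 b2 xm by (simp add: diff_divide_distrib)
  also have "\<dots> = 1" using d by (simp add: algebra_simps)
  finally show "a\<^sup>2 + b\<^sup>2 = 1" .
  have a: "a > 0" unfolding a_def defs(2-)[symmetric] using x N m \<mu> by simp
  show b: "b < 0" unfolding b_def defs(2-)[symmetric] using x N m \<mu>
    by (intro divide_neg_pos mult_pos_neg) auto
  have \<kappa>: "\<kappa> > 0" "\<kappa>\<^sup>2 = Q / (Q - 1)" using Q by (simp_all add: \<kappa>_def defs)
  \<comment> \<open>Both sides are nonnegative, so it is enough to compare squares; since
    \<open>b < 0\<close>, the second identity is about \<open>- \<kappa> * b\<close>.\<close>
  have "(\<kappa> * a)\<^sup>2 = ((1 - x1) / sqrt (N1 * m1))\<^sup>2"
    using x N m d Q unfolding power_mult_distrib \<kappa> a2 xm QX Nx(1)[symmetric]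
    by (simp add: power_divide power_mult_distrib) (simp add: Nx power2_eq_square field_simps)
  then show "\<kappa> * a = (1 - xj q \<mu> 1) / sqrt (Nj q \<mu> 1 * mj q \<mu> 1)"
    unfolding defs(2-)[symmetric] using a \<kappa> x N m by (subst (asm) power2_eq_iff_nonneg) auto
  have "(- \<kappa> * b)\<^sup>2 = ((1 - x2) / sqrt (N2 * m2))\<^sup>2"
    using x N m d Q unfolding power_mult_distrib power2_minus \<kappa> b2 xm QX
    by (simp add: power_divide power_mult_distrib) (simp add: Nx power2_eq_square field_simps)
  moreover have "- \<kappa> * b \<ge> 0" using \<kappa> b by (simp add: mult_nonneg_nonpos)
  moreover have "(1 - x2) / sqrt (N2 * m2) \<ge> 0" unfolding xm using Q m N by simp
  ultimately show "- \<kappa> * b = (1 - xj q \<mu> 2) / sqrt (Nj q \<mu> 2 * mj q \<mu> 2)"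
    unfolding defs(2-)[symmetric] by (subst (asm) power2_eq_iff_nonneg) auto
qed

section \<open>The exponents of \<open>S\<close> as differences of squares\<close>

definition S_integrand :: "nat \<Rightarrow> nat \<Rightarrow> real \<Rightarrow> (nat \<Rightarrow> nat \<Rightarrow> real) \<Rightarrow> real" where
  "S_integrand n q \<mu> u = ln ((1 / real q) * (\<Sum>l\<in>{1..q}.
       exp (- (\<mu> / 2) * (G_fun n q \<mu> u l + 2 * (if l = q then 1 else 0) * T_fun n q \<mu> u))))"

text \<open>Completing the square: \<open>G\<close> is the square of \<open>v\<close> plus twice its
  product with \<open>c\<close>, where \<open>v\<close> combines the first \<open>q - 2\<close>
  vectors. The subtracted square of \<open>c\<close> is the same for all \<open>l\<close>, so it can
  be pulled out of the sum.\<close>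

lemma G_fun_eq:
  "G_fun n q \<mu> u l = (\<Sum>i\<in>{1..n}.
     (u (q - 1) i / sqrt (Nj q \<mu> 1) + u q i / sqrt (Nj q \<mu> 2) + (\<Sum>m\<in>{1..q-2}. alpha m l * u m i))\<^sup>2
     - (u (q - 1) i / sqrt (Nj q \<mu> 1) + u q i / sqrt (Nj q \<mu> 2))\<^sup>2)"
proof -
  define v where "v i = (\<Sum>m\<in>{1..q-2}. alpha m l * u m i)" for i
  have 1: "(\<Sum>m\<in>{1..q-2}. \<Sum>m'\<in>{1..q-2}. alpha m l * alpha m' l * dotv n (u m) (u m')) = (\<Sum>i\<in>{1..n}. (v i)\<^sup>2)"
  proof -
    have "(\<Sum>i\<in>{1..n}. (v i)\<^sup>2)
      = (\<Sum>i\<in>{1..n}. \<Sum>m\<in>{1..q-2}. \<Sum>m'\<in>{1..q-2}. (alpha m l * u m i) * (alpha m' l * u m' i))"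
      unfolding v_def power2_eq_square sum_product ..
    also have "\<dots> = (\<Sum>m\<in>{1..q-2}. \<Sum>i\<in>{1..n}. \<Sum>m'\<in>{1..q-2}. (alpha m l * u m i) * (alpha m' l * u m' i))"
      by (rule sum.swap)
    also have "\<dots> = (\<Sum>m\<in>{1..q-2}. \<Sum>m'\<in>{1..q-2}. \<Sum>i\<in>{1..n}. (alpha m l * u m i) * (alpha m' l * u m' i))"
      by (intro sum.cong refl sum.swap)
    finally show ?thesis by (simp add: dotv_def sum_distrib_left mult_ac)
  qed
  have 2: "(\<Sum>m\<in>{1..q-2}. alpha m l * dotv n (u m) y) = (\<Sum>i\<in>{1..n}. v i * y i)" for y
  proof -
    have "(\<Sum>m\<in>{1..q-2}. alpha m l * dotv n (u m) y) = (\<Sum>m\<in>{1..q-2}. \<Sum>i\<in>{1..n}. alpha m l * u m i * y i)"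
      by (simp add: dotv_def sum_distrib_left mult.assoc)
    also have "\<dots> = (\<Sum>i\<in>{1..n}. \<Sum>m\<in>{1..q-2}. alpha m l * u m i * y i)" by (rule sum.swap)
    finally show ?thesis by (simp add: v_def sum_distrib_right)
  qed
  show ?thesis
    unfolding G_fun_def 1 2 v_def[symmetric]
    by (simp add: sum_distrib_left sum_divide_distrib sum.distrib[symmetric] power2_eq_square algebra_simps)
qed

text \<open>The coefficients of \<open>T\<close> come from expanding the square of \<open>D\<close>
  minus the square of \<open>c\<close>; the latter is also subtracted in
  \<open>G_fun_eq\<close>.\<close>

lemma T_fun_eq:
  assumes "Nj q \<mu> 1 > 0" "Nj q \<mu> 2 > 0"
  shows "2 * T_fun n q \<mu> u = (\<Sum>i\<in>{1..n}.
     (xj q \<mu> 1 * u (q - 1) i / sqrt (Nj q \<mu> 1) + xj q \<mu> 2 * u q i / sqrt (Nj q \<mu> 2))\<^sup>2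
     - (u (q - 1) i / sqrt (Nj q \<mu> 1) + u q i / sqrt (Nj q \<mu> 2))\<^sup>2)"
proof -
  define r1 r2 where r: "r1 = sqrt (Nj q \<mu> 1)" "r2 = sqrt (Nj q \<mu> 2)"
  have N: "Nj q \<mu> 1 = r1\<^sup>2" "Nj q \<mu> 2 = r2\<^sup>2" and r0: "r1 > 0" "r2 > 0"
    using assms by (simp_all add: r)
  have "(xj q \<mu> 1 * u (q - 1) i / r1 + xj q \<mu> 2 * u q i / r2)\<^sup>2 - (u (q - 1) i / r1 + u q i / r2)\<^sup>2
    = 2 * (((xj q \<mu> 2)\<^sup>2 - 1) / (2 * r2\<^sup>2) * (u q i * u q i)
     + ((xj q \<mu> 1)\<^sup>2 - 1) / (2 * r1\<^sup>2) * (u (q - 1) i * u (q - 1) i)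
     + (xj q \<mu> 1 * xj q \<mu> 2 - 1) / (r1 * r2) * (u q i * u (q - 1) i))" for i
    using r0 by (simp add: power2_eq_square field_simps)
  then show ?thesis
    using r0 unfolding T_fun_def dotv_def r[symmetric] N
    by (simp add: sum_distrib_left sum.distrib[symmetric])
qed

lemma G_fun_last:
  assumes "q \<ge> 2"
  shows "G_fun n q \<mu> u q = 0"
proof -
  \<comment> \<open>\<open>m \<le> q - 2\<close> gives \<open>m + 1 < q\<close>, so all contrasts in
    \<open>G\<close> vanish on the last vector.\<close>
  have "alpha m q = 0" if "m \<in> {1..q-2}" for m
    using that assms by (auto simp: alpha_def)
  then show ?thesis by (simp add: G_fun_def)
qed

text \<open>The normalised sum in slot \<open>q\<close> cancels. Only the last contrast, number
  \<open>q - 1\<close>, involves vector \<open>q\<close>; its coefficients on all other vectors are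
  equal, and they exceed the one on vector \<open>q\<close> by \<open>\<kappa>\<close>.\<close>

lemma helmert_inv_diff:
  assumes q: "q \<ge> 2" and l: "l \<in> {1..q-1}" and i: "i \<in> I"
  shows "helmert_inv I q w l i - helmert_inv I q w q i
    = (\<Sum>m\<in>{1..q-2}. alpha m l * w m i) + sqrt (real q / (real q - 1)) * w (q - 1) i"
proof -
  have I: "{1..<q} = insert (q - 1) {1..q-2}" "q - 1 \<notin> {1..q-2}" using q by auto
  have "alpha m q = 0" if "m \<in> {1..q-2}" for m
    using that q by (auto simp: alpha_def)
  then have "helmert_inv I q w l i - helmert_inv I q w q i
    = (\<Sum>m\<in>{1..q-2}. alpha m l * w m i) + (alpha (q - 1) l - alpha (q - 1) q) * w (q - 1) i"
    using I q l i by (auto simp: helmert_inv_def left_diff_distrib)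
  moreover have "alpha (q - 1) l - alpha (q - 1) q = sqrt (real q / (real q - 1))"
  proof -
    define p where "p = real q"
    have p: "p > 1" "real (q - 1) = p - 1" using q by (auto simp: p_def)
    have "alpha (q - 1) l - alpha (q - 1) q = 1 / sqrt ((p - 1) * p) + (p - 1) / sqrt ((p - 1) * p)"
      using q l p by (auto simp: alpha_def diff_divide_distrib)
    also have "\<dots> = (sqrt p * sqrt p) / (sqrt (p - 1) * sqrt p)"
      using p by (simp add: add_divide_distrib[symmetric] real_sqrt_mult)
    also have "\<dots> = sqrt (p / (p - 1))"
      using p by (simp add: real_sqrt_divide del: real_sqrt_mult_self)
    finally show ?thesis by (simp add: p_def)
  qed
  ultimately show ?thesis by simp
qed

text \<open>The hypotheses express \<open>D\<close> and \<open>c\<close> through \<open>u\<close>.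
  Each exponent of \<open>S\<close> then exceeds that of \<open>neg_log_mix\<close> by the same
  \<open>\<mu> / 2 * c2\<close>, which leaves the logarithm as a summand.\<close>

lemma neg_log_mix_helmert:
  assumes q: "q \<ge> 2" and \<mu>: "\<mu> > 0"
    and u: "\<And>m i. m \<in> {1..q-2} \<Longrightarrow> i \<in> {1..n} \<Longrightarrow> u m i = w m i"
    and D: "\<And>i. i \<in> {1..n} \<Longrightarrow> w 0 i / sqrt \<mu>
      = xj q \<mu> 1 * u (q - 1) i / sqrt (Nj q \<mu> 1) + xj q \<mu> 2 * u q i / sqrt (Nj q \<mu> 2)"
    and c: "\<And>i. i \<in> {1..n} \<Longrightarrow> w 0 i / sqrt \<mu> + sqrt (real q / (real q - 1)) * w (q - 1) i
      = u (q - 1) i / sqrt (Nj q \<mu> 1) + u q i / sqrt (Nj q \<mu> 2)"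
  shows "- S_integrand n q \<mu> u = neg_log_mix n q (sqrt \<mu>) q (helmert_inv {1..n} q w)
    - \<mu> / 2 * (\<Sum>i\<in>{1..n}. (w 0 i / sqrt \<mu> + sqrt (real q / (real q - 1)) * w (q - 1) i)\<^sup>2)"
proof -
  define \<kappa> where "\<kappa> = sqrt (real q / (real q - 1))"
  define c2 where "c2 = (\<Sum>i\<in>{1..n}. (w 0 i / sqrt \<mu> + \<kappa> * w (q - 1) i)\<^sup>2)"
  define X where "X = helmert_inv {1..n} q w"
  define A where "A l = (\<Sum>i\<in>{1..n}. (X 0 i + sqrt \<mu> * (X l i - X q i))\<^sup>2) / 2" for l
  \<comment> \<open>The Helmert transformation leaves the noise slot 0 alone; this form exposes the
    factor \<open>sqrt \<mu>\<close> shared with the differences of centres.\<close>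
  have X0: "X 0 i = sqrt \<mu> * (w 0 i / sqrt \<mu>)" for i
    using \<mu> by (simp add: X_def helmert_inv_def)
  have "- (\<mu> / 2) * (G_fun n q \<mu> u l + 2 * (if l = q then 1 else 0) * T_fun n q \<mu> u)
      = - A l + \<mu> / 2 * c2" if l: "l \<in> {1..q}" for l
  proof (cases "l = q")
    case True
    \<comment> \<open>For \<open>l = q\<close> the difference of centres is zero and only the noise,
      \<open>sqrt \<mu> * D\<close>, remains.\<close>
    have "A l = \<mu> / 2 * (\<Sum>i\<in>{1..n}. (w 0 i / sqrt \<mu>)\<^sup>2)"
      using \<mu> True unfolding A_def X0 by (simp add: power_mult_distrib power_divide sum_divide_distrib[symmetric])
    moreover have "2 * T_fun n q \<mu> u = (\<Sum>i\<in>{1..n}. (w 0 i / sqrt \<mu>)\<^sup>2) - c2"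
      using c D unfolding T_fun_eq[OF xj_Nj(6,7)[OF q \<mu>]] c2_def sum_subtractf[symmetric] \<kappa>_def
      by (intro sum.cong refl) simp
    ultimately show ?thesis
      using True G_fun_last[OF q] by (simp add: right_diff_distrib)
  next
    case False
    then have l': "l \<in> {1..q-1}" using l by auto
    define v where "v i = (\<Sum>m\<in>{1..q-2}. alpha m l * u m i)" for i
    have "X l i - X q i = v i + \<kappa> * w (q - 1) i" if "i \<in> {1..n}" for i
      using helmert_inv_diff[OF q l' that] u that unfolding X_def v_def \<kappa>_def by (simp cong: sum.cong_simp)
    then have "A l = (\<Sum>i\<in>{1..n}. (sqrt \<mu> * (w 0 i / sqrt \<mu> + \<kappa> * w (q - 1) i + v i))\<^sup>2) / 2"
      unfolding A_def X0 by (intro arg_cong[of _ _ "\<lambda>x. x / 2"] sum.cong refl) (simp add: algebra_simps)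
    also have "\<dots> = \<mu> / 2 * (\<Sum>i\<in>{1..n}. (w 0 i / sqrt \<mu> + \<kappa> * w (q - 1) i + v i)\<^sup>2)"
      using \<mu> by (simp only: power_mult_distrib sum_distrib_left[symmetric]) simp
    finally have "A l = \<mu> / 2 * (\<Sum>i\<in>{1..n}. (w 0 i / sqrt \<mu> + \<kappa> * w (q - 1) i + v i)\<^sup>2)" .
    moreover have "G_fun n q \<mu> u l = (\<Sum>i\<in>{1..n}. (w 0 i / sqrt \<mu> + \<kappa> * w (q - 1) i + v i)\<^sup>2) - c2"
      using c unfolding G_fun_eq c2_def sum_subtractf[symmetric] \<kappa>_def v_def
      by (intro sum.cong refl) simp
    ultimately show ?thesis using False by (simp add: right_diff_distrib)
  qed
  then have "S_integrand n q \<mu> u = ln ((1 / real q) * (\<Sum>l\<in>{1..q}. exp (- A l + \<mu> / 2 * c2)))"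
    unfolding S_integrand_def
    by (intro arg_cong[of _ _ "\<lambda>S. ln (1 / real q * S)"] sum.cong refl arg_cong[of _ _ exp])
  also have "(1 / real q) * (\<Sum>l\<in>{1..q}. exp (- A l + \<mu> / 2 * c2))
    = ((1 / real q) * (\<Sum>l\<in>{1..q}. exp (- A l))) * exp (\<mu> / 2 * c2)"
    by (simp only: exp_add sum_distrib_right[symmetric] mult.assoc)
  also have "ln \<dots> = ln ((1 / real q) * (\<Sum>l\<in>{1..q}. exp (- A l))) + \<mu> / 2 * c2"
    using q by (subst ln_mult_pos) (auto intro!: mult_pos_pos divide_pos_pos sum_pos)
  finally show ?thesis
    unfolding neg_log_mix_def X_def[symmetric] A_def c2_def \<kappa>_def by simp
qed

section \<open>The expectation defining \<open>S\<close>\<close>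

lemma measurable_S_integrand:
  assumes q: "q \<ge> 2"
  shows "S_integrand n q \<mu> \<in> borel_measurable (PiM {1..q} (\<lambda>_. PiM {1..n} (\<lambda>_. borel)))"
proof -
  let ?B = "PiM {1..q} (\<lambda>_. PiM {1..n} (\<lambda>_. borel :: real measure))"
  have coord: "(\<lambda>u. u k i) \<in> borel_measurable ?B" if "k \<in> {1..q}" "i \<in> {1..n}" for k i
    using measurable_compose[OF measurable_component_singleton[OF that(1), of "\<lambda>_. PiM {1..n} (\<lambda>_. borel :: real measure)"]
      measurable_component_singleton[OF that(2)]] by simp
  have dot: "(\<lambda>u. dotv n (u k) (u k')) \<in> borel_measurable ?B" if "k \<in> {1..q}" "k' \<in> {1..q}" for k k'
    unfolding dotv_def using that coord by (intro borel_measurable_sum borel_measurable_times)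
  have G: "(\<lambda>u. G_fun n q \<mu> u l) \<in> borel_measurable ?B" for l
    unfolding G_fun_def using q
    by (intro borel_measurable_add borel_measurable_times borel_measurable_const borel_measurable_sum dot) auto
  have T: "(\<lambda>u. T_fun n q \<mu> u) \<in> borel_measurable ?B"
    unfolding T_fun_def using q
    by (intro borel_measurable_add borel_measurable_times borel_measurable_const dot) auto
  show ?thesis
    unfolding S_integrand_def[abs_def]
    by (intro borel_measurable_ln borel_measurable_times borel_measurable_const borel_measurable_sum
        measurable_compose[OF _ borel_measurable_exp] borel_measurable_add G T)
qed

text \<open>Up to the factor \<open>\<rho>\<close>, the combination is slot \<open>p\<close> after a
  rotation, hence a standard vector.\<close>

lemma integral_sqnorm_combination:
  assumes I: "finite I" and K: "finite K" "p \<in> K" "r \<in> K" "p \<noteq> r" and b: "b \<noteq> 0"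
  shows "integrable (gauss_tuple K I) (\<lambda>w. \<Sum>i\<in>I. (b * w r i + a * w p i)\<^sup>2)"
    and "(\<integral>w. (\<Sum>i\<in>I. (b * w r i + a * w p i)\<^sup>2) \<partial>gauss_tuple K I) = (a\<^sup>2 + b\<^sup>2) * real (card I)"
proof -
  let ?G = "gauss_tuple K I"
  define \<rho> where "\<rho> = sqrt (a\<^sup>2 + b\<^sup>2)"
  have ab: "a\<^sup>2 + b\<^sup>2 > 0" using b by (simp add: sum_power2_gt_zero_iff)
  then have \<rho>: "\<rho> > 0" "\<rho>\<^sup>2 = a\<^sup>2 + b\<^sup>2" by (simp_all add: \<rho>_def)
  have 1: "(a / \<rho>)\<^sup>2 + (- b / \<rho>)\<^sup>2 = 1" "- b / \<rho> \<noteq> 0"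
    using ab b \<rho> by (simp_all add: power_divide add_divide_distrib[symmetric])
  define R where "R = rot_slots I (a / \<rho>) (- b / \<rho>) p r"
  have m: "R \<in> measurable ?G ?G" unfolding R_def using I K(2-4) by (rule measurable_rot_slots)
  have d: "distr ?G ?G R = ?G" unfolding R_def using I K 1 by (rule distr_rot_slots)
  have eq: "(\<Sum>i\<in>I. (b * w r i + a * w p i)\<^sup>2) = \<rho>\<^sup>2 * (\<Sum>i\<in>I. (R w p i)\<^sup>2)" for w
  proof -
    have "b * w r i + a * w p i = \<rho> * R w p i" if "i \<in> I" for i
      using that K(4) \<rho> by (simp add: R_def rot_slots_def field_simps)
    then show ?thesis by (simp add: power_mult_distrib sum_distrib_left cong: sum.cong)
  qed
  have f: "(\<lambda>w. \<Sum>i\<in>I. (w p i)\<^sup>2) \<in> borel_measurable ?G"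
    using gauss_tuple_sqnorm(1)[OF K(2)] by (rule borel_measurable_integrable)
  have "integrable ?G (\<lambda>w. \<Sum>i\<in>I. (R w p i)\<^sup>2)"
    using gauss_tuple_sqnorm(1)[OF K(2), of I] integrable_distr[OF m, of "\<lambda>w. \<Sum>i\<in>I. (w p i)\<^sup>2"] unfolding d by simp
  then show "integrable ?G (\<lambda>w. \<Sum>i\<in>I. (b * w r i + a * w p i)\<^sup>2)"
    unfolding eq by simp
  have "(\<integral>w. (\<Sum>i\<in>I. (R w p i)\<^sup>2) \<partial>?G) = real (card I)"
    using gauss_tuple_sqnorm(2)[OF K(2), of I] integral_distr[OF m f] unfolding d by simp
  then show "(\<integral>w. (\<Sum>i\<in>I. (b * w r i + a * w p i)\<^sup>2) \<partial>?G) = (a\<^sup>2 + b\<^sup>2) * real (card I)"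
    unfolding eq using \<rho> by simp
qed

text \<open>Everything is moved to the tuple of \<open>q + 1\<close> standard vectors. There the
  integrand of \<open>S\<close> is that of the entropy after \<open>R\<close> and \<open>H\<close>,
  both of which preserve the law, minus \<open>\<mu> / 2 * c2\<close> after \<open>R\<close>, whose
  mean is the subtracted term.\<close>

lemma S_term_eq:
  assumes q: "q \<ge> 2" and \<mu>: "\<mu> > 0"
  shows "S_term n q \<mu> = (\<integral>w. neg_log_mix n q (sqrt \<mu>) q w \<partial>gauss_tuple (insert 0 {1..q}) {1..n})
    - real n / 2 * (1 + real q / (real q - 1) * \<mu>)"
proof -
  let ?K = "insert 0 {1..q}"
  let ?G = "gauss_tuple ?K {1..n}"
  let ?B = "PiM {1..q} (\<lambda>_. PiM {1..n} (\<lambda>_. borel :: real measure))"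
  define \<kappa> where "\<kappa> = sqrt (real q / (real q - 1))"
  define a where "a = sqrt \<mu> * xj q \<mu> 2 / sqrt (Nj q \<mu> 2 * mj q \<mu> 2)"
  define b where "b = sqrt \<mu> * xj q \<mu> 1 / sqrt (Nj q \<mu> 1 * mj q \<mu> 1)"
  note rot = eigenvector_rotation[OF q \<mu>, folded a_def b_def \<kappa>_def]
  note m = mj_Vieta[OF q \<mu>]
  \<comment> \<open>Rotates the last contrast \<open>h\<close> in slot \<open>q - 1\<close> with the
    noise in slot 0.\<close>
  define R where "R = rot_slots {1..n} a b (q - 1) 0"
  define H where "H = helmert_inv {1..n} q"
  \<comment> \<open>Slot \<open>q\<close> holds the normalised sum, on which no exponent depends;
    \<open>u\<^sub>q\<close> is therefore read from slot 0.\<close>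
  define t where "t k = (if k = q then 0 else k)" for k
  define sd where "sd k = sqrt (1 / dk q \<mu> k)" for k
  define U where "U w = (\<lambda>k\<in>{1..q}. \<lambda>i\<in>{1..n}. sd k * w (t k) i)" for w :: "nat \<Rightarrow> nat \<Rightarrow> real"
  define c2 where "c2 w = (\<Sum>i\<in>{1..n}. ((1 / sqrt \<mu>) * w 0 i + \<kappa> * w (q - 1) i)\<^sup>2)" for w :: "nat \<Rightarrow> nat \<Rightarrow> real"
  have q1: "q - 1 \<in> ?K" "0 \<in> ?K" "q - 1 \<noteq> 0" using q by auto
  have R: "R \<in> measurable ?G ?G" "distr ?G ?G R = ?G"
    unfolding R_def using q1 rot(1,2)
    by (auto intro!: measurable_rot_slots distr_rot_slots simp del: insert_iff)
  have H: "H \<in> measurable ?G ?G" "distr ?G ?G H = ?G"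
    using distr_helmert_inv[of "{1..n}" ?K q] q unfolding H_def by auto
  note L = measurable_neg_log_mix[of q q n "sqrt \<mu>"] and Li = integrable_neg_log_mix[of q q n "sqrt \<mu>"]
  have qq: "q \<in> {1..q}" using q by simp
  have HL: "(\<lambda>w. neg_log_mix n q (sqrt \<mu>) q (H w)) \<in> borel_measurable ?G"
    using measurable_compose[OF H(1) L[OF qq]] .
  have HLi: "integrable ?G (\<lambda>w. neg_log_mix n q (sqrt \<mu>) q (H w))"
    using integrable_distr[OF H(1), of "neg_log_mix n q (sqrt \<mu>) q"] Li[OF qq] unfolding H(2) by simp
  have HLv: "(\<integral>w. neg_log_mix n q (sqrt \<mu>) q (H w) \<partial>?G) = (\<integral>w. neg_log_mix n q (sqrt \<mu>) q w \<partial>?G)"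
    using integral_distr[OF H(1) L[OF qq]] unfolding H(2) by simp
  have c2: "integrable ?G c2" "(\<integral>w. c2 w \<partial>?G) = (\<kappa>\<^sup>2 + 1 / \<mu>) * real n"
    unfolding c2_def[abs_def]
    using integral_sqnorm_combination[of "{1..n}" ?K "q - 1" 0 "1 / sqrt \<mu>" \<kappa>] q1 \<mu>
    by (auto simp: power_divide simp del: insert_iff)
  have sd: "sd k > 0" for k
    using m(3,4) by (auto simp: sd_def dk_def)
  have t: "inj_on t {1..q}" "t \<in> {1..q} \<rightarrow> ?K"
    by (auto simp: t_def inj_on_def)
  have U_measure: "U_measure n q \<mu> = distr ?G ?B U"
    unfolding U_measure_def sd_def[symmetric] U_def[abs_def]
    by (rule PiM_PiM_normal_eq_distr[OF _ _ sd t]) auto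
  have "(\<lambda>w. sd k * w (t k) i) \<in> borel_measurable ?G" if "k \<in> {1..q}" "i \<in> {1..n}" for k i
    using that(2) funcset_mem[OF t(2) that(1)]
    by (intro borel_measurable_times borel_measurable_const measurable_gauss_tuple_coord)
  then have U: "U \<in> measurable ?G ?B"
    unfolding U_def[abs_def] by (intro measurable_restrict)
  \<comment> \<open>\<open>U\<close> reads the tuple before the rotation, \<open>neg_log_mix\<close>
    sees it after \<open>R\<close> and then \<open>H\<close>.\<close>
  have integrand: "- S_integrand n q \<mu> (U w) = neg_log_mix n q (sqrt \<mu>) q (H (R w)) - \<mu> / 2 * c2 (R w)" for w
  proof -
    have u1: "U w (q - 1) i = w (q - 1) i / sqrt (mj q \<mu> 1)"
      and u2: "U w q i = w 0 i / sqrt (mj q \<mu> 2)" if "i \<in> {1..n}" for i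
      using that q by (auto simp: U_def sd_def t_def dk_def real_sqrt_divide)
    have R0: "R w 0 i = b * w (q - 1) i + a * w 0 i"
      and R1: "R w (q - 1) i = a * w (q - 1) i - b * w 0 i" if "i \<in> {1..n}" for i
      using that q1 by (auto simp: R_def rot_slots_def)
    have "U w k i = R w k i" if "k \<in> {1..q-2}" "i \<in> {1..n}" for k i
      using that q by (auto simp: U_def sd_def t_def dk_def R_def rot_slots_def)
    moreover have D: "R w 0 i / sqrt \<mu>
      = xj q \<mu> 1 * U w (q - 1) i / sqrt (Nj q \<mu> 1) + xj q \<mu> 2 * U w q i / sqrt (Nj q \<mu> 2)"
      if "i \<in> {1..n}" for i
      unfolding R0[OF that] u1[OF that] u2[OF that] a_def b_def using \<mu>
      by (simp add: add_divide_distrib real_sqrt_mult mult.commute)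
    moreover have "R w 0 i / sqrt \<mu> + \<kappa> * R w (q - 1) i
      = U w (q - 1) i / sqrt (Nj q \<mu> 1) + U w q i / sqrt (Nj q \<mu> 2)"
      if i: "i \<in> {1..n}" for i
    proof -
      \<comment> \<open>The coefficients produced here are \<open>1 - x\<^sub>j\<close>; adding
        \<open>D\<close>, with coefficients \<open>x\<^sub>j\<close>, leaves the coefficients 1 of
        \<open>c\<close>.\<close>
      have "\<kappa> * R w (q - 1) i = (\<kappa> * a) * w (q - 1) i + (- \<kappa> * b) * w 0 i"
        unfolding R1[OF i] by (simp add: algebra_simps)
      also have "\<dots> = (1 - xj q \<mu> 1) * U w (q - 1) i / sqrt (Nj q \<mu> 1)
          + (1 - xj q \<mu> 2) * U w q i / sqrt (Nj q \<mu> 2)"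
        unfolding rot(3,4) u1[OF i] u2[OF i] by (simp add: real_sqrt_mult mult.commute)
      finally show ?thesis
        unfolding D[OF i] by (simp add: diff_divide_distrib left_diff_distrib)
    qed
    ultimately show ?thesis
      unfolding H_def c2_def \<kappa>_def by (subst neg_log_mix_helmert[OF q \<mu>]) auto
  qed
  have "S_term n q \<mu> = (\<integral>u. - S_integrand n q \<mu> u \<partial>distr ?G ?B U)"
    unfolding S_term_def U_measure S_integrand_def by simp
  also have "\<dots> = (\<integral>w. - S_integrand n q \<mu> (U w) \<partial>?G)"
    using measurable_S_integrand[OF q] by (intro integral_distr U borel_measurable_uminus)
  also have "\<dots> = (\<integral>w. neg_log_mix n q (sqrt \<mu>) q (H (R w)) - \<mu> / 2 * c2 (R w) \<partial>?G)"
    unfolding integrand ..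
  \<comment> \<open>Both terms are evaluated at \<open>R w\<close>, so this is an integral under the
    image law of \<open>R\<close>, which is \<open>?G\<close> again.\<close>
  also have "\<dots> = (\<integral>w. neg_log_mix n q (sqrt \<mu>) q (H w) - \<mu> / 2 * c2 w \<partial>distr ?G ?G R)"
    using HL c2(1) by (intro integral_distr[symmetric] R(1)) auto
  also have "\<dots> = (\<integral>w. neg_log_mix n q (sqrt \<mu>) q w \<partial>?G) - \<mu> / 2 * ((\<kappa>\<^sup>2 + 1 / \<mu>) * real n)"
    unfolding R(2) using HLi c2 HLv by simp
  also have "\<mu> / 2 * ((\<kappa>\<^sup>2 + 1 / \<mu>) * real n) = real n / 2 * (1 + real q / (real q - 1) * \<mu>)"
    using q \<mu> by (simp add: \<kappa>_def field_simps)
  finally show ?thesis .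
qed

theorem theorem2:
  fixes n q :: nat and \<sigma> s \<mu> :: real
  assumes "n \<ge> 1" and "q \<ge> 2" and "\<sigma> > 0" and "s > 0"
    and "\<mu> = s\<^sup>2 / \<sigma>\<^sup>2"
  shows "cond_entropy n q \<sigma> s =
           real n * ln (\<sigma> * sqrt (2 * pi * exp 1))
           + real n / 2 * (real q / (real q - 1)) * \<mu> + S_term n q \<mu>"
proof -
  have \<mu>: "\<mu> > 0" "sqrt \<mu> = s / \<sigma>"
    using assms by (simp_all add: real_sqrt_divide)
  \<comment> \<open>The extra \<open>1 / 2\<close>, multiplied by \<open>n\<close>, matches the
    summand \<open>n / 2\<close> in \<open>S_term_eq\<close>.\<close>
  have "ln (\<sigma> * sqrt (2 * pi * exp 1)) = ln (2 * pi * \<sigma>\<^sup>2) / 2 + 1 / 2"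
    using \<open>\<sigma> > 0\<close> by (simp add: ln_mult_pos ln_sqrt ln_realpow add_divide_distrib)
  then show ?thesis
    using cond_entropy_eq[of \<sigma> s q n] S_term_eq[of q \<mu> n] assms(2-4) \<mu>
    by (simp add: algebra_simps)
qed

end
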